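(* Let $s\ge 1$ be an integer, $m=[s/2]$, and let $\alpha>0$. Let $\psi_i$ be the explicit eigenfunctions of the Whittaker--Hill operator $L=-\frac{d^2}{dx^2}-(4\alpha s\cos 2x+2\alpha^2\cos 4x)$ defined in the context, indexed by $i\in\{0,1,\dots,2m\}$ if $s=2m+1$ is odd and by $i\in\{1,\dots,2m\}$ if $s=2m$ is even. Then for every nonempty cluster subset $I=\{i_1,\dots,i_k\}$ of the index set, the Wronskian $W_I(x)=W(\psi_{i_1},\dots,\psi_{i_k})(x)$ has no zeros on the real line.
   Context: Write $D=\frac{d}{dx}$. Eigenfunctions. Put $K=-D^2+4\alpha(\sin 2x)D-4(s-1)\alpha\cos 2x$. If $\varphi$ satisfies $K\varphi=\nu\varphi$, then $\psi=\varphi e^{\alpha\cos 2x}$ satisfies $L\psi=\lambda\psi$ with $\lambda=\nu-2\alpha^2$. For odd $s=2m+1$, $K$ preserves the $s$-dimensional space spanned by $1,\cos 2jx,\sin 2jx$ ($1\le j\le m$). For even $s=2m$, $K$ preserves the $s$-dimensional space spanned by $\cos(2j-1)x,\sin(2j-1)x$ ($1\le j\le m$). For $\alpha>0$ the restriction of $K$ to this space has $s$ distinct real eigenvalues. They are listed in increasing order as $\nu_0<\nu_1<\dots<\nu_{2m}$ if $s=2m+1$, and as $\nu_1<\dots<\nu_{2m}$ if $s=2m$. Let $\varphi_i$ be the corresponding real eigenfunctions in this space (unique up to a nonzero scalar), and let $\psi_i=\varphi_i e^{\alpha\cos 2x}$. Cluster subsets. A cluster is any pair $\{2j-1,2j\}$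 with $1\le j\le m$ and, when $s=2m+1$ is odd, also the single-element set $\{0\}$. A cluster subset of the index set is a subset that is a union of clusters. Equivalently, for each $j=1,\dots,m$ it contains $2j-1$ if and only if it contains $2j$. $W(f_1,\dots,f_k)=\det\big(D^{p-1}f_q\big)_{p,q=1}^k$ denotes the Wronskian. *)

theory Defs
  imports "HOL-Analysis.Derivative" "Jordan_Normal_Form.Determinant"
begin

definition L_op :: "nat \<Rightarrow> real \<Rightarrow> (real \<Rightarrow> real) \<Rightarrow> real \<Rightarrow> real" where
  "L_op s \<alpha> f x = - (deriv ^^ 2) f x
     - (4 * \<alpha> * real s * cos (2 * x) + 2 * \<alpha>\<^sup>2 * cos (4 * x)) * f x"

definition K_op :: "nat \<Rightarrow> real \<Rightarrow> (real \<Rightarrow> real) \<Rightarrow> real \<Rightarrow> real" where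
  "K_op s \<alpha> f x = - (deriv ^^ 2) f x + 4 * \<alpha> * sin (2 * x) * deriv f x
     - 4 * (real s - 1) * \<alpha> * cos (2 * x) * f x"

text \<open>The \<open>s\<close>-dimensional space of trigonometric polynomials preserved by \<open>K_op s \<alpha>\<close>,
  written as the set of explicit real linear combinations of its basis.\<close>

definition trig_space :: "nat \<Rightarrow> (real \<Rightarrow> real) set" where
  "trig_space s =
    (if odd s
     then {f. \<exists>c a b. f = (\<lambda>x. c + (\<Sum>j = 1..s div 2.
                 a j * cos (2 * real j * x) + b j * sin (2 * real j * x)))}
     else {f. \<exists>a b. f = (\<lambda>x. \<Sum>j = 1..s div 2.
                 a j * cos ((2 * real j - 1) * x) + b j * sin ((2 * real j - 1) * x))})"

definition K_eigenfunction :: "nat \<Rightarrow> real \<Rightarrow> real \<Rightarrow> (real \<Rightarrow> real) \<Rightarrow> bool" where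
  "K_eigenfunction s \<alpha> \<mu> f \<longleftrightarrow>
     f \<in> trig_space s \<and> f \<noteq> (\<lambda>x. 0) \<and> K_op s \<alpha> f = (\<lambda>x. \<mu> * f x)"

definition K_eigenvalues :: "nat \<Rightarrow> real \<Rightarrow> real set" where
  "K_eigenvalues s \<alpha> = {\<mu>. \<exists>f. K_eigenfunction s \<alpha> \<mu> f}"

definition index_set :: "nat \<Rightarrow> nat set" where
  "index_set s = (if odd s then {0..2 * (s div 2)} else {1..2 * (s div 2)})"

definition clusters :: "nat \<Rightarrow> nat set set" where
  "clusters s = {{2 * j - 1, 2 * j} | j. 1 \<le> j \<and> j \<le> s div 2} \<union> (if odd s then {{0}} else {})"

definition cluster_subset :: "nat \<Rightarrow> nat set \<Rightarrow> bool" where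
  "cluster_subset s I \<longleftrightarrow> (\<exists>F \<subseteq> clusters s. I = \<Union> F)"

text \<open>\<open>\<nu>\<close> lists the eigenvalues of \<open>K_op s \<alpha>\<close> on \<open>trig_space s\<close> in increasing order
  (with indices starting at 0 for odd \<open>s\<close> and at 1 for even \<open>s\<close>), and \<open>\<phi> i\<close> is some choice
  of eigenfunction for \<open>\<nu> i\<close>. Values outside the index set are irrelevant.\<close>

definition eigensystem :: "nat \<Rightarrow> real \<Rightarrow> (nat \<Rightarrow> real) \<Rightarrow> (nat \<Rightarrow> real \<Rightarrow> real) \<Rightarrow> bool" where
  "eigensystem s \<alpha> \<nu> \<phi> \<longleftrightarrow>
     strict_mono_on (index_set s) \<nu> \<and> \<nu> ` index_set s = K_eigenvalues s \<alpha> \<and>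
     (\<forall>i \<in> index_set s. K_eigenfunction s \<alpha> (\<nu> i) (\<phi> i))"

definition psi :: "real \<Rightarrow> (real \<Rightarrow> real) \<Rightarrow> real \<Rightarrow> real" where
  "psi \<alpha> f x = f x * exp (\<alpha> * cos (2 * x))"

text \<open>Rows and columns are counted from 0, so row \<open>p\<close> carries the \<open>p\<close>-th derivative.\<close>

definition wronskian :: "(real \<Rightarrow> real) list \<Rightarrow> real \<Rightarrow> real" where
  "wronskian fs x = det (mat (length fs) (length fs) (\<lambda>(p, q). (deriv ^^ p) (fs ! q) x))"

lemma cluster_subset_iff:
  "cluster_subset s I \<longleftrightarrow>
     I \<subseteq> index_set s \<and> (\<forall>j \<in> {1..s div 2}. 2 * j - 1 \<in> I \<longleftrightarrow> 2 * j \<in> I)"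
proof
  assume "cluster_subset s I"
  then obtain F where F: "F \<subseteq> clusters s" "I = \<Union> F"
    by (auto simp: cluster_subset_def)
  have disj: "C = {2 * j - 1, 2 * j}"
    if C: "C \<in> clusters s" and "2 * j - 1 \<in> C \<or> 2 * j \<in> C" and "1 \<le> j" for C j
  proof (cases "C = {0}")
    case False
    then obtain i where i: "C = {2 * i - 1, 2 * i}" "1 \<le> i"
      using C False by (auto simp: clusters_def split: if_splits)
    have "i = j" proof -
      have "2 * j - 1 = 2 * i - 1 \<or> 2 * j - 1 = 2 * i \<or> 2 * j = 2 * i - 1 \<or> 2 * j = 2 * i"
        using that(2) unfolding i(1) by blast
      then show ?thesis using that(3) i(2) by presburger
    qed
    then show ?thesis using i by simp
  qed (use that in auto)
  have "I \<subseteq> index_set s"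
  proof
    fix i assume "i \<in> I"
    then obtain C where "C \<in> clusters s" "i \<in> C" using F by blast
    moreover have "2 * j \<le> s - Suc 0" if "odd s" "j \<le> s div 2" for j
      using that by presburger
    ultimately show "i \<in> index_set s"
      by (auto simp: clusters_def index_set_def split: if_splits)
  qed
  moreover have "2 * j - 1 \<in> I \<longleftrightarrow> 2 * j \<in> I" if "j \<in> {1..s div 2}" for j
  proof -
    have j: "1 \<le> j" using that by simp
    have "2 * j - 1 \<in> C \<longleftrightarrow> 2 * j \<in> C" if "C \<in> F" for C
      using disj[of C j] F(1) j that by blast
    then show ?thesis unfolding F(2) by blast
  qed
  ultimately show "I \<subseteq> index_set s \<and> (\<forall>j \<in> {1..s div 2}. 2 * j - 1 \<in> I \<longleftrightarrow> 2 * j \<in> I)"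
    by blast
next
  assume I: "I \<subseteq> index_set s \<and> (\<forall>j \<in> {1..s div 2}. 2 * j - 1 \<in> I \<longleftrightarrow> 2 * j \<in> I)"
  have "\<exists>C \<in> clusters s. i \<in> C \<and> C \<subseteq> I" if "i \<in> I" for i
  proof (cases "i = 0")
    case True
    then have "odd s" using I that by (auto simp: index_set_def split: if_splits)
    then show ?thesis using True that by (intro bexI[of _ "{0}"]) (auto simp: clusters_def)
  next
    case False
    define j where "j = (i + 1) div 2"
    have i: "i = 2 * j - 1 \<or> i = 2 * j" unfolding j_def by presburger
    have le: "i \<le> 2 * (s div 2)" using I that by (auto simp: index_set_def split: if_splits)
    have j: "1 \<le> j" "j \<le> s div 2" using i le False unfolding j_def by presburger+
    have "{2 * j - 1, 2 * j} \<in> clusters s" using j by (auto simp: clusters_def)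
    moreover have "{2 * j - 1, 2 * j} \<subseteq> I" using I i that j by auto
    moreover have "i \<in> {2 * j - 1, 2 * j}" using i by simp
    ultimately show ?thesis by (intro bexI[of _ "{2 * j - 1, 2 * j}"] conjI)
  qed
  then have "I = \<Union> {C \<in> clusters s. C \<subseteq> I}" by blast
  then show "cluster_subset s I"
    unfolding cluster_subset_def by (intro exI[of _ "{C \<in> clusters s. C \<subseteq> I}"] conjI) auto
qed

lemma trig_space_derivs:
  assumes "f \<in> trig_space s"
  obtains f' f'' where "\<And>x. (f has_real_derivative f' x) (at x)"
    "\<And>x. (f' has_real_derivative f'' x) (at x)"
proof -
  have *: "\<exists>f' f''. (\<forall>x. ((\<lambda>x. c + (\<Sum>j = 1..n. a j * cos (w j * x) + b j * sin (w j * x)))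
        has_real_derivative f' x) (at x)) \<and> (\<forall>x. (f' has_real_derivative f'' x) (at x))"
    for c and a b w :: "nat \<Rightarrow> real" and n
    by (rule exI[of _ "\<lambda>x. \<Sum>j = 1..n. - a j * w j * sin (w j * x) + b j * w j * cos (w j * x)"],
        rule exI[of _ "\<lambda>x. \<Sum>j = 1..n. - a j * w j * w j * cos (w j * x)
          - b j * w j * w j * sin (w j * x)"])
      (auto intro!: derivative_eq_intros sum.cong simp: algebra_simps)
  have "\<exists>c a b w. f = (\<lambda>x. c + (\<Sum>j = 1..s div 2. a j * cos (w j * x) + b j * sin (w j * x)))"
  proof (cases "odd s")
    case True
    then obtain c a b where "f = (\<lambda>x. c + (\<Sum>j = 1..s div 2.
        a j * cos (2 * real j * x) + b j * sin (2 * real j * x)))"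
      using assms by (auto simp: trig_space_def)
    then show ?thesis
      by (intro exI[of _ c] exI[of _ a] exI[of _ b] exI[of _ "\<lambda>j. 2 * real j"]) simp
  next
    case False
    then obtain a b where "f = (\<lambda>x. \<Sum>j = 1..s div 2.
        a j * cos ((2 * real j - 1) * x) + b j * sin ((2 * real j - 1) * x))"
      using assms by (auto simp: trig_space_def)
    then show ?thesis
      by (intro exI[of _ 0] exI[of _ a] exI[of _ b] exI[of _ "\<lambda>j. 2 * real j - 1"]) simp
  qed
  then obtain c a b w where
    f: "f = (\<lambda>x. c + (\<Sum>j = 1..s div 2. a j * cos (w j * x) + b j * sin (w j * x)))"
    by (elim exE)
  show ?thesis using *[of c a w b "s div 2"] that unfolding f by blast
qed

lemma L_op_psi:
  assumes "K_eigenfunction s \<alpha> \<mu> f"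
  shows "L_op s \<alpha> (psi \<alpha> f) = (\<lambda>x. (\<mu> - 2 * \<alpha>\<^sup>2) * psi \<alpha> f x)"
proof
  fix x
  obtain f' f'' where d1: "\<And>x. (f has_real_derivative f' x) (at x)"
    and d2: "\<And>x. (f' has_real_derivative f'' x) (at x)"
    using assms trig_space_derivs unfolding K_eigenfunction_def by metis
  have f': "deriv f = f'" using d1 by (auto intro: DERIV_imp_deriv)
  have f'': "deriv f' = f''" using d2 by (auto intro: DERIV_imp_deriv)
  define e where "e = (\<lambda>x. exp (\<alpha> * cos (2 * x)))"
  have g: "psi \<alpha> f = (\<lambda>x. f x * e x)" by (auto simp: psi_def e_def)
  have de: "(e has_real_derivative (- 2 * \<alpha> * sin (2 * x) * e x)) (at x)" for x
    unfolding e_def by (auto intro!: derivative_eq_intros)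
  have g': "deriv (\<lambda>x. f x * e x) = (\<lambda>x. (f' x - 2 * \<alpha> * sin (2 * x) * f x) * e x)"
    by (rule ext, rule DERIV_imp_deriv)
      (rule derivative_eq_intros d1 de refl | simp add: algebra_simps)+
  have g'': "deriv (\<lambda>x. (f' x - 2 * \<alpha> * sin (2 * x) * f x) * e x) x =
     (f'' x - 4 * \<alpha> * sin (2 * x) * f' x - 4 * \<alpha> * cos (2 * x) * f x
       + 4 * \<alpha>\<^sup>2 * (sin (2 * x))\<^sup>2 * f x) * e x"
    by (rule DERIV_imp_deriv)
      (rule derivative_eq_intros d1 d2 de refl | simp add: algebra_simps power2_eq_square)+
  have K: "f'' x = 4 * \<alpha> * sin (2 * x) * f' x
      - 4 * (real s - 1) * \<alpha> * cos (2 * x) * f x - \<mu> * f x"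
  proof -
    have "K_op s \<alpha> f x = \<mu> * f x" using assms by (simp add: K_eigenfunction_def)
    then show ?thesis by (simp add: K_op_def f' f'' numeral_2_eq_2)
  qed
  have c4: "cos (4 * x) = 1 - 2 * (sin (2 * x))\<^sup>2"
    using cos_double_sin[of "2 * x"] by simp
  show "L_op s \<alpha> (psi \<alpha> f) x = (\<mu> - 2 * \<alpha>\<^sup>2) * psi \<alpha> f x"
    unfolding L_op_def g by (simp add: numeral_2_eq_2 g' g'' K c4)
      (simp add: algebra_simps power2_eq_square)
qed

end

theory Submission
  imports Defs
begin

text \<open>Two facts about the eigenfunctions of a Hill operator drive the proof. If \<open>\<lambda>\<^sub>f < \<lambda>\<^sub>g\<close> and
  \<open>W(f, g)\<close> vanishes somewhere, then by Sturm comparison and parity \<open>g\<close> has at least two more zeros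
  per period than \<open>f\<close>; and \<open>W(f, g)\<close>, \<open>W(g, h)\<close> cannot both be zero-free when
  \<open>\<lambda>\<^sub>f < \<lambda>\<^sub>g < \<lambda>\<^sub>h\<close>, because \<open>W(f, h) / (W(g, f) W(g, h))\<close> is periodic but decreasing.
  As \<open>\<psi>\<^sub>i\<close> with the top index has at most \<open>s - 1\<close> zeros per period, this leaves no choice for the zero
  counts, and the members of a cluster have equally many zeros and hence a zero-free Wronskian.
  The Darboux transform by the highest cluster \<open>{a, b}\<close> of \<open>I\<close> is thus regular, and
  \<open>\<psi>\<^sub>b / W\<close>, \<open>\<psi>\<^sub>a / W\<close> replace the two annihilated eigenfunctions on top of the new system without
  increasing the zero counts, so the argument can be repeated with the lower clusters.\<close>

section \<open>Smooth functions and order of vanishing\<close>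

text \<open>\<open>deriv\<close> is total, so the existence of each derivative has to be asserted
  separately. Peeling off the first derivative lets product and quotient rules be proved by
  induction with the functions kept arbitrary.\<close>

fun kdiff :: "nat \<Rightarrow> (real \<Rightarrow> real) \<Rightarrow> bool" where
  "kdiff 0 f \<longleftrightarrow> True"
| "kdiff (Suc n) f \<longleftrightarrow> (\<forall>x. (f has_real_derivative deriv f x) (at x)) \<and> kdiff n (deriv f)"

lemma deriv_eqI:
  assumes "\<And>x. (f has_real_derivative f' x) (at x)"
  shows "deriv f = f'"
  using assms by (auto intro: DERIV_imp_deriv)

lemma kdiff_SucI:
  assumes "\<And>x. (f has_real_derivative f' x) (at x)" "kdiff n f'"
  shows "kdiff (Suc n) f"
  using assms deriv_eqI[OF assms(1)] by simp

lemma kdiff_SucD: "kdiff (Suc n) f \<Longrightarrow> kdiff n f"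
  by (induction n arbitrary: f) auto

lemma kdiff_const: "kdiff n (\<lambda>x. c)"
proof (induction n arbitrary: c)
  case (Suc n)
  show ?case by (rule kdiff_SucI[where f' = "\<lambda>x. 0"]) (auto simp: Suc)
qed simp

lemma kdiff_add: "kdiff n f \<Longrightarrow> kdiff n g \<Longrightarrow> kdiff n (\<lambda>x. f x + g x)"
proof (induction n arbitrary: f g)
  case (Suc n)
  then show ?case
    by (intro kdiff_SucI[where f' = "\<lambda>x. deriv f x + deriv g x"] DERIV_add) auto
qed simp

lemma kdiff_mult: "kdiff n f \<Longrightarrow> kdiff n g \<Longrightarrow> kdiff n (\<lambda>x. f x * g x)"
proof (induction n arbitrary: f g)
  case (Suc n)
  have "kdiff n f" "kdiff n g" using Suc.prems kdiff_SucD by blast+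
  then have "kdiff n (\<lambda>x. deriv f x * g x + deriv g x * f x)"
    using Suc by (intro kdiff_add) auto
  then show ?case
    using Suc.prems
    by (intro kdiff_SucI[where f' = "\<lambda>x. deriv f x * g x + deriv g x * f x"] DERIV_mult) auto
qed simp

lemma kdiff_inverse:
  "kdiff n f \<Longrightarrow> (\<And>x. f x \<noteq> 0) \<Longrightarrow> kdiff n (\<lambda>x. inverse (f x))"
proof (induction n)
  case (Suc n)
  have "kdiff n (\<lambda>x. inverse (f x))" using Suc kdiff_SucD by blast
  then have "kdiff n (\<lambda>x. - 1 * deriv f x * (inverse (f x) * inverse (f x)))"
    using Suc.prems by (intro kdiff_mult kdiff_const) auto
  moreover have "((\<lambda>x. inverse (f x)) has_real_derivative
      - 1 * deriv f x * (inverse (f x) * inverse (f x))) (at x)" for x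
    using Suc.prems by (auto intro!: derivative_eq_intros)
  ultimately show ?case by (rule kdiff_SucI[rotated])
qed simp

lemma kdiff_exp: "kdiff n f \<Longrightarrow> kdiff n (\<lambda>x. exp (f x))"
proof (induction n)
  case (Suc n)
  have "kdiff n (\<lambda>x. deriv f x * exp (f x))"
    using Suc kdiff_SucD by (intro kdiff_mult) auto
  moreover have "((\<lambda>x. exp (f x)) has_real_derivative deriv f x * exp (f x)) (at x)" for x
    using Suc.prems by (auto intro!: derivative_eq_intros)
  ultimately show ?case by (rule kdiff_SucI[rotated])
qed simp

lemma kdiff_cos_sin: "kdiff n (\<lambda>x. cos (w * x)) \<and> kdiff n (\<lambda>x. sin (w * x))"
proof (induction n)
  case (Suc n)
  have c: "((\<lambda>x. cos (w * x)) has_real_derivative - w * sin (w * x)) (at x)"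
   and s: "((\<lambda>x. sin (w * x)) has_real_derivative w * cos (w * x)) (at x)" for x
    by (auto intro!: derivative_eq_intros)
  show ?case using Suc
    by (intro conjI kdiff_SucI[OF c] kdiff_SucI[OF s] kdiff_mult kdiff_const) auto
qed simp

definition smooth :: "(real \<Rightarrow> real) \<Rightarrow> bool" where
  "smooth f \<longleftrightarrow> (\<forall>n. kdiff n f)"

lemma smooth_DERIV: "smooth f \<Longrightarrow> (f has_real_derivative deriv f x) (at x)"
  unfolding smooth_def using kdiff.simps(2) by blast

lemma smooth_deriv: "smooth f \<Longrightarrow> smooth (deriv f)"
  unfolding smooth_def using kdiff.simps(2) by blast

lemma smooth_const: "smooth (\<lambda>x. c)"
  and smooth_add: "smooth f \<Longrightarrow> smooth g \<Longrightarrow> smooth (\<lambda>x. f x + g x)"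
  and smooth_mult: "smooth f \<Longrightarrow> smooth g \<Longrightarrow> smooth (\<lambda>x. f x * g x)"
  and smooth_exp: "smooth f \<Longrightarrow> smooth (\<lambda>x. exp (f x))"
  and smooth_cos: "smooth (\<lambda>x. cos (w * x))"
  and smooth_sin: "smooth (\<lambda>x. sin (w * x))"
  by (auto simp: smooth_def kdiff_const kdiff_add kdiff_mult kdiff_exp kdiff_cos_sin)

lemma smooth_diff: "smooth f \<Longrightarrow> smooth g \<Longrightarrow> smooth (\<lambda>x. f x - g x)"
  using smooth_add[OF _ smooth_mult[OF smooth_const[of "- 1"]], of f g] by simp

lemma smooth_divide:
  "smooth f \<Longrightarrow> smooth g \<Longrightarrow> (\<And>x. g x \<noteq> 0) \<Longrightarrow> smooth (\<lambda>x. f x / g x)"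
  unfolding divide_inverse by (intro smooth_mult) (auto simp: smooth_def kdiff_inverse)

lemma smooth_sum: "(\<And>i. i \<in> A \<Longrightarrow> smooth (f i)) \<Longrightarrow> smooth (\<lambda>x. \<Sum>i\<in>A. f i x)"
  by (induction A rule: infinite_finite_induct) (auto intro: smooth_const smooth_add)

lemmas smooth_intros = smooth_const smooth_add smooth_mult smooth_exp smooth_cos smooth_sin
  smooth_diff smooth_divide smooth_sum smooth_deriv

lemma smooth_cont: "smooth f \<Longrightarrow> continuous_on A f"
  by (meson DERIV_isCont continuous_at_imp_continuous_on smooth_DERIV)

lemma smooth_higher_deriv: "smooth f \<Longrightarrow> smooth ((deriv ^^ p) f)"
  by (induction p) (auto intro: smooth_deriv)

lemma deriv_lincomb:
  assumes "\<And>i. i \<in> A \<Longrightarrow> smooth (f i)"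
  shows "deriv (\<lambda>x. \<Sum>i\<in>A. c i * f i x) = (\<lambda>x. \<Sum>i\<in>A. c i * deriv (f i) x)"
proof (rule deriv_eqI)
  fix x
  show "((\<lambda>x. \<Sum>i\<in>A. c i * f i x) has_real_derivative (\<Sum>i\<in>A. c i * deriv (f i) x)) (at x)"
    by (intro DERIV_sum DERIV_cmult smooth_DERIV assms)
qed

lemma higher_deriv_lincomb:
  assumes "\<And>i. i \<in> A \<Longrightarrow> smooth (f i)"
  shows "(deriv ^^ p) (\<lambda>x. \<Sum>i\<in>A. c i * f i x) = (\<lambda>x. \<Sum>i\<in>A. c i * (deriv ^^ p) (f i) x)"
proof (induction p)
  case (Suc p)
  then show ?case
    using deriv_lincomb[of A "\<lambda>i. (deriv ^^ p) (f i)" c] smooth_higher_deriv assms by simp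
qed simp

section \<open>Vanishing to a given order at a point\<close>

definition vanishes :: "nat \<Rightarrow> (real \<Rightarrow> real) \<Rightarrow> real \<Rightarrow> bool" where
  "vanishes k f x \<longleftrightarrow> (\<forall>p<k. (deriv ^^ p) f x = 0)"

lemma vanishes_0: "vanishes 0 f x"
  by (simp add: vanishes_def)

lemma vanishes_Suc: "vanishes (Suc k) f x \<longleftrightarrow> f x = 0 \<and> vanishes k (deriv f) x"
  unfolding vanishes_def All_less_Suc2 by (simp add: funpow_swap1)

lemma vanishes_mono: "vanishes k f x \<Longrightarrow> j \<le> k \<Longrightarrow> vanishes j f x"
  by (auto simp: vanishes_def)

lemma vanishes_add:
  "smooth f \<Longrightarrow> smooth g \<Longrightarrow> vanishes k f x \<Longrightarrow> vanishes k g x \<Longrightarrow> vanishes k (\<lambda>x. f x + g x) x"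
proof (induction k arbitrary: f g)
  case (Suc k)
  have "deriv (\<lambda>x. f x + g x) = (\<lambda>x. deriv f x + deriv g x)"
    using Suc.prems by (intro deriv_eqI DERIV_add smooth_DERIV)
  then show ?case using Suc by (simp add: vanishes_Suc smooth_deriv)
qed (simp add: vanishes_0)

lemma vanishes_mult:
  "smooth f \<Longrightarrow> smooth g \<Longrightarrow> vanishes k g x \<Longrightarrow> vanishes k (\<lambda>x. f x * g x) x"
proof (induction k arbitrary: f g)
  case (Suc k)
  have "deriv (\<lambda>x. f x * g x) = (\<lambda>x. deriv f x * g x + f x * deriv g x)"
    by (rule deriv_eqI)
      (use smooth_DERIV[OF Suc.prems(1)] smooth_DERIV[OF Suc.prems(2)] in
        \<open>auto intro!: derivative_eq_intros\<close>)
  moreover have "vanishes k g x" using Suc.prems(3) vanishes_mono[of "Suc k"] by simp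
  ultimately show ?case using Suc
    by (auto simp: vanishes_Suc intro!: vanishes_add smooth_intros)
qed (simp add: vanishes_0)

section \<open>Eigenfunctions of a Hill operator\<close>

definition wr :: "(real \<Rightarrow> real) \<Rightarrow> (real \<Rightarrow> real) \<Rightarrow> real \<Rightarrow> real" where
  "wr f g x = f x * deriv g x - deriv f x * g x"

text \<open>The last conjunct, simplicity of the zeros, stands in for nontriviality: unlike the
  latter it is inherited by Darboux transforms without an appeal to uniqueness for ODEs.\<close>

definition eigfun :: "real \<Rightarrow> (real \<Rightarrow> real) \<Rightarrow> real \<Rightarrow> (real \<Rightarrow> real) \<Rightarrow> bool" where
  "eigfun \<sigma> u l f \<longleftrightarrow> smooth f \<and> (\<forall>x. f (x + pi) = \<sigma> * f x) \<and>
     (\<forall>x. deriv (deriv f) x = (u x - l) * f x) \<and> (\<forall>x. f x \<noteq> 0 \<or> deriv f x \<noteq> 0)"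

lemma eigfunD:
  assumes "eigfun \<sigma> u l f"
  shows "smooth f" "f (x + pi) = \<sigma> * f x" "deriv (deriv f) x = (u x - l) * f x"
    "f x \<noteq> 0 \<or> deriv f x \<noteq> 0"
  using assms by (auto simp: eigfun_def)

lemma deriv_shift:
  assumes "smooth f" "\<And>x. f (x + pi) = \<sigma> * f x"
  shows "deriv f (x + pi) = \<sigma> * deriv f x"
proof -
  have "((\<lambda>x. f (x + pi)) has_real_derivative deriv f (x + pi)) (at x)"
    using smooth_DERIV[OF assms(1), of "x + pi"] DERIV_shift by blast
  moreover have "((\<lambda>x. \<sigma> * f x) has_real_derivative \<sigma> * deriv f x) (at x)"
    by (intro DERIV_cmult smooth_DERIV assms(1))
  ultimately show ?thesis unfolding assms(2) by (rule DERIV_unique)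
qed

lemma smooth_wr: "smooth f \<Longrightarrow> smooth g \<Longrightarrow> smooth (wr f g)"
  unfolding wr_def[abs_def] by (intro smooth_intros)

text \<open>In \<open>f g'' - f'' g\<close> the common potential \<open>u\<close> cancels, and only
  the difference of the eigenvalues survives.\<close>

lemma DERIV_wr:
  assumes "eigfun \<sigma> u l f" "eigfun \<sigma> u k g"
  shows "(wr f g has_real_derivative (l - k) * (f x * g x)) (at x)"
proof -
  note D = eigfunD(1)[OF assms(1)] eigfunD(1)[OF assms(2)]
  show ?thesis unfolding wr_def[abs_def]
    using smooth_DERIV[OF D(1)] smooth_DERIV[OF D(2)] smooth_DERIV[OF smooth_deriv[OF D(1)]]
      smooth_DERIV[OF smooth_deriv[OF D(2)]]
    by (auto intro!: derivative_eq_intros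
        simp: eigfunD(3)[OF assms(1)] eigfunD(3)[OF assms(2)] algebra_simps)
qed

lemma wr_shift:
  assumes "eigfun \<sigma> u l f" "eigfun \<sigma> u k g" "\<sigma> * \<sigma> = 1"
  shows "wr f g (x + pi) = wr f g x"
proof -
  have "wr f g (x + pi) = (\<sigma> * \<sigma>) * wr f g x"
    unfolding wr_def eigfunD(2)[OF assms(1)] eigfunD(2)[OF assms(2)]
      deriv_shift[OF eigfunD(1,2)[OF assms(1)]] deriv_shift[OF eigfunD(1,2)[OF assms(2)]]
    by (simp add: algebra_simps)
  then show ?thesis using assms(3) by simp
qed

section \<open>Darboux transforms\<close>

text \<open>Where \<open>w\<close> has no zeros this is \<open>u - 2 (log |w|)''\<close>, expanded
  so that the sign of \<open>w\<close> is irrelevant.\<close>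

definition darboux_potential :: "(real \<Rightarrow> real) \<Rightarrow> (real \<Rightarrow> real) \<Rightarrow> real \<Rightarrow> real" where
  "darboux_potential u w x = u x - 2 * (deriv (deriv w) x * w x - (deriv w x)\<^sup>2) / (w x)\<^sup>2"

text \<open>Hypothesis \<open>eq\<close> is the transformed eigenvalue equation for
  \<open>N / w\<close> with denominators cleared; the terms in \<open>(w')^2\<close> from the
  quotient rule and from the potential cancel. At a zero of \<open>N\<close> the quotient has
  derivative \<open>N' / w\<close>, so zeros stay simple.\<close>

lemma eigfun_quotient:
  assumes N: "smooth N" "\<And>x. N (x + pi) = \<sigma> * N x" "\<And>x. N x \<noteq> 0 \<or> deriv N x \<noteq> 0"
    and w: "smooth w" "\<And>x. w (x + pi) = w x" "\<And>x. w x \<noteq> 0"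
    and eq: "\<And>x. (deriv (deriv N) x - (u x - l) * N x) * w x
      = 2 * deriv N x * deriv w x - deriv (deriv w) x * N x"
  shows "eigfun \<sigma> (darboux_potential u w) l (\<lambda>x. N x / w x)"
proof -
  note D = smooth_DERIV[OF N(1)] smooth_DERIV[OF smooth_deriv[OF N(1)]]
    smooth_DERIV[OF w(1)] smooth_DERIV[OF smooth_deriv[OF w(1)]]
  have d1: "deriv (\<lambda>x. N x / w x) = (\<lambda>x. (deriv N x * w x - N x * deriv w x) / (w x * w x))"
    by (rule deriv_eqI, rule DERIV_divide[OF D(1,3) w(3)])
  have d2: "deriv (\<lambda>x. (deriv N x * w x - N x * deriv w x) / (w x * w x)) x =
      ((deriv (deriv N) x * w x - N x * deriv (deriv w) x) * (w x * w x)
        - (deriv N x * w x - N x * deriv w x) * (2 * w x * deriv w x)) / (w x * w x * (w x * w x))"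
    for x
    by (rule DERIV_imp_deriv)
      (rule derivative_eq_intros D refl | simp add: w(3) algebra_simps)+
  have "deriv (deriv (\<lambda>x. N x / w x)) x = (darboux_potential u w x - l) * (N x / w x)" for x
  proof -
    have "deriv (deriv N) x = (u x - l) * N x
        + (2 * deriv N x * deriv w x - deriv (deriv w) x * N x) / w x"
      using eq[of x] w(3)[of x] by (simp add: field_simps)
    then show ?thesis unfolding d1 d2 darboux_potential_def using w(3)[of x]
      by (simp add: divide_simps) (simp add: algebra_simps power2_eq_square)
  qed
  moreover have "N x / w x \<noteq> 0 \<or> deriv (\<lambda>x. N x / w x) x \<noteq> 0" for x
    unfolding d1 using N(3)[of x] w(3)[of x] by auto
  moreover have "smooth (\<lambda>x. N x / w x)" using N w by (intro smooth_intros)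
  ultimately show ?thesis unfolding eigfun_def using N(2) w(2) by simp
qed

text \<open>This is \<open>W(a, b, f) / W(a, b)\<close>, the 3 by 3 Wronskian being expanded along
  the column of \<open>f\<close>.\<close>

definition darboux :: "(real \<Rightarrow> real) \<Rightarrow> (real \<Rightarrow> real) \<Rightarrow> (real \<Rightarrow> real) \<Rightarrow> real \<Rightarrow> real" where
  "darboux a b f x = deriv (deriv f) x - deriv (wr a b) x / wr a b x * deriv f x
     + (deriv a x * deriv (deriv b) x - deriv (deriv a) x * deriv b x) / wr a b x * f x"

context
  fixes \<sigma> la lb :: real and u a b :: "real \<Rightarrow> real"
  assumes \<sigma>: "\<sigma> * \<sigma> = 1" and a: "eigfun \<sigma> u la a" and b: "eigfun \<sigma> u lb b"
    and nz: "\<And>x. wr a b x \<noteq> 0"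
begin

lemma deriv_wr_ab: "deriv (wr a b) = (\<lambda>x. (la - lb) * (a x * b x))"
  by (intro deriv_eqI DERIV_wr[OF a b])

lemma deriv2_wr_ab:
  "deriv (\<lambda>x. (la - lb) * (a x * b x)) x = (la - lb) * (deriv a x * b x + a x * deriv b x)"
  by (rule DERIV_imp_deriv)
   (rule derivative_eq_intros smooth_DERIV eigfunD(1)[OF a] eigfunD(1)[OF b] refl
     | simp add: algebra_simps)+

text \<open>Both eigenvalues of the pair keep an eigenfunction for the new potential, but the
  numerators are interchanged: \<open>b\<close> now belongs to \<open>la\<close> and
  \<open>a\<close> to \<open>lb\<close>.\<close>

lemma eigfun_darboux_swap:
  "eigfun \<sigma> (darboux_potential u (wr a b)) la (\<lambda>x. b x / wr a b x)"
  "eigfun \<sigma> (darboux_potential u (wr a b)) lb (\<lambda>x. a x / wr a b x)"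
proof -
  note w = smooth_wr[OF eigfunD(1)[OF a] eigfunD(1)[OF b]] wr_shift[OF a b \<sigma>] nz
  show "eigfun \<sigma> (darboux_potential u (wr a b)) la (\<lambda>x. b x / wr a b x)"
    by (rule eigfun_quotient[OF eigfunD(1,2,4)[OF b] w])
      (unfold deriv_wr_ab, unfold deriv2_wr_ab eigfunD(3)[OF b], unfold wr_def, simp add: algebra_simps)
  show "eigfun \<sigma> (darboux_potential u (wr a b)) lb (\<lambda>x. a x / wr a b x)"
    by (rule eigfun_quotient[OF eigfunD(1,2,4)[OF a] w])
      (unfold deriv_wr_ab, unfold deriv2_wr_ab eigfunD(3)[OF a], unfold wr_def, simp add: algebra_simps)
qed

lemma eigfun_darboux:
  assumes f: "eigfun \<sigma> u l f" and l: "l \<noteq> la" "l \<noteq> lb"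
  shows "eigfun \<sigma> (darboux_potential u (wr a b)) l (darboux a b f)"
proof -
  define P where "P = wr a f"
  define Q where "Q = wr b f"
  \<comment> \<open>This is \<open>W(a, b, f)\<close> after the second derivatives have been
    eliminated by the eigenvalue equations.\<close>
  define N where "N = (\<lambda>x. (lb - l) * (b x * P x) - (la - l) * (a x * Q x))"
  define N1 where "N1 = (\<lambda>x. (lb - l) * (deriv b x * P x) - (la - l) * (deriv a x * Q x))"
  note sm = eigfunD(1)[OF a] eigfunD(1)[OF b] eigfunD(1)[OF f]
  have D: "(P has_real_derivative (la - l) * (a x * f x)) (at x)"
    "(Q has_real_derivative (lb - l) * (b x * f x)) (at x)" for x
    unfolding P_def Q_def by (rule DERIV_wr[OF a f] DERIV_wr[OF b f])+
  \<comment> \<open>Cramer's rule: since \<open>wr a b\<close> has no zeros, \<open>P\<close> and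
    \<open>Q\<close> determine \<open>f\<close> and \<open>f'\<close>.\<close>
  have PQ: "wr a b x * f x = b x * P x - a x * Q x"
    "wr a b x * deriv f x = deriv b x * P x - deriv a x * Q x" for x
    by (simp_all add: P_def Q_def wr_def algebra_simps)
  \<comment> \<open>The contributions of \<open>P'\<close> and \<open>Q'\<close> are both
    \<open>(la - l) (lb - l) a b f\<close> and cancel.\<close>
  have N1: "deriv N = N1"
    unfolding N_def N1_def
    by (rule deriv_eqI)
      (rule derivative_eq_intros smooth_DERIV sm D refl | simp add: algebra_simps)+
  have N2: "deriv N1 x = (u x - l) * N x
      + (la - lb) * ((lb - l) * (b x * P x) + (la - l) * (a x * Q x))" for x
  proof -
    have "deriv N1 x = (lb - l) * ((u x - lb) * b x * P x) - (la - l) * ((u x - la) * a x * Q x)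
       + (lb - l) * (la - l) * (wr a b x * f x)"
      unfolding N1_def
      by (rule DERIV_imp_deriv)
        (rule derivative_eq_intros smooth_DERIV smooth_deriv sm D refl
          | simp add: wr_def eigfunD(3)[OF a] eigfunD(3)[OF b] algebra_simps)+
    then show ?thesis unfolding PQ N_def by (simp add: algebra_simps)
  qed
  have "darboux a b f = (\<lambda>x. N x / wr a b x)"
  proof
    fix x
    have "wr a b x * darboux a b f x = wr a b x * ((u x - l) * f x)
        - (la - lb) * (a x * b x) * deriv f x
        + (deriv a x * (u x - lb) * b x - (u x - la) * a x * deriv b x) * f x"
      using nz[of x] by (simp add: darboux_def deriv_wr_ab eigfunD(3)[OF a] eigfunD(3)[OF b]
        eigfunD(3)[OF f] field_simps)
    also have "\<dots> = N x" by (simp add: N_def P_def Q_def wr_def algebra_simps)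
    finally show "darboux a b f x = N x / wr a b x" using nz[of x] by (simp add: field_simps)
  qed
  moreover have "eigfun \<sigma> (darboux_potential u (wr a b)) l (\<lambda>x. N x / wr a b x)"
  proof (rule eigfun_quotient)
    show "smooth N" unfolding N_def P_def Q_def by (intro smooth_intros smooth_wr sm)
    show "N (x + pi) = \<sigma> * N x" for x
      unfolding N_def P_def Q_def wr_shift[OF a f \<sigma>] wr_shift[OF b f \<sigma>] eigfunD(2)[OF a]
         eigfunD(2)[OF b] by (simp add: algebra_simps)
    show "N x \<noteq> 0 \<or> deriv N x \<noteq> 0" for x
    proof (rule ccontr)
      assume "\<not> ?thesis"
      then have 0: "N x = 0" "N1 x = 0" by (auto simp: N1)
      \<comment> \<open>\<open>N\<close> and \<open>N1\<close> are linear in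
        \<open>(lb - l) P\<close> and \<open>(la - l) Q\<close> with determinant
        \<open>wr a b\<close> up to sign. A double zero of \<open>N\<close> thus forces
        \<open>P = Q = 0\<close>, and then \<open>f = f' = 0\<close> by \<open>PQ\<close>.\<close>
      have "wr a b x * ((lb - l) * P x) = a x * N1 x - deriv a x * N x"
        "wr a b x * ((la - l) * Q x) = b x * N1 x - deriv b x * N x"
        by (simp_all add: N_def N1_def wr_def algebra_simps)
      then have "P x = 0" "Q x = 0" using 0 nz[of x] l by auto
      then show False using PQ[of x] nz[of x] eigfunD(4)[OF f, of x] by auto
    qed
    show "smooth (wr a b)" by (intro smooth_wr sm)
    show "(deriv (deriv N) x - (u x - l) * N x) * wr a b x =
        2 * deriv N x * deriv (wr a b) x - deriv (deriv (wr a b)) x * N x" for x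
      unfolding N1 N2 unfolding deriv_wr_ab unfolding deriv2_wr_ab
      unfolding N_def N1_def wr_def by (simp add: algebra_simps)
  qed (use wr_shift[OF a b \<sigma>] nz in auto)
  ultimately show ?thesis by simp
qed

lemma darboux_annihilates: "darboux a b a x = 0" "darboux a b b x = 0"
  using nz[of x]
  by (simp_all add: darboux_def deriv_wr_ab eigfunD(3)[OF a] eigfunD(3)[OF b] divide_simps)
    (simp_all add: wr_def algebra_simps)

text \<open>A second-order differential operator with smooth coefficients lowers the order of
  vanishing by at most two.\<close>

lemma vanishes_darboux:
  assumes "smooth f" "vanishes (Suc (Suc k)) f x"
  shows "vanishes k (darboux a b f) x"
proof -
  note sm = eigfunD(1)[OF a] eigfunD(1)[OF b] assms(1)
  define p where "p = (\<lambda>x. - 1 * deriv (wr a b) x / wr a b x)"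
  define q where "q = (\<lambda>x. (deriv a x * deriv (deriv b) x - deriv (deriv a) x * deriv b x) / wr a b x)"
  have pq: "smooth p" "smooth q" unfolding p_def q_def
    by (intro smooth_intros smooth_wr sm nz)+
  have "vanishes k f x" "vanishes k (deriv f) x" "vanishes k (deriv (deriv f)) x"
    using assms(2) vanishes_mono[of "Suc (Suc k)" f x k] vanishes_mono[of "Suc k" "deriv f" x k]
    by (auto simp: vanishes_Suc)
  then have "vanishes k (\<lambda>x. deriv (deriv f) x + p x * deriv f x + q x * f x) x"
    by (intro vanishes_add vanishes_mult smooth_intros pq sm)
  then show ?thesis by (simp add: darboux_def[abs_def] p_def q_def)
qed

end

lemma darboux_lincomb:
  assumes "\<And>i. i \<in> A \<Longrightarrow> smooth (f i)"
  shows "darboux a b (\<lambda>x. \<Sum>i\<in>A. c i * f i x) = (\<lambda>x. \<Sum>i\<in>A. c i * darboux a b (f i) x)"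
proof -
  have d1: "deriv (\<lambda>x. \<Sum>i\<in>A. c i * f i x) = (\<lambda>x. \<Sum>i\<in>A. c i * deriv (f i) x)"
    by (rule deriv_lincomb) (rule assms)
  have d2: "deriv (deriv (\<lambda>x. \<Sum>i\<in>A. c i * f i x)) = (\<lambda>x. \<Sum>i\<in>A. c i * deriv (deriv (f i)) x)"
    unfolding d1 by (rule deriv_lincomb) (intro smooth_deriv assms)
  have lin: "(\<Sum>i\<in>A. c i * p i) - r * (\<Sum>i\<in>A. c i * q i) + t * (\<Sum>i\<in>A. c i * v i)
      = (\<Sum>i\<in>A. c i * (p i - r * q i + t * v i))" for p q v :: "'a \<Rightarrow> real" and r t
    unfolding sum_distrib_left sum_subtractf[symmetric] sum.distrib[symmetric]
    by (intro sum.cong) (auto simp: algebra_simps)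
  show ?thesis
    unfolding darboux_def[abs_def] d2 unfolding d1 by (simp only: lin)
qed

section \<open>Counting zeros per period\<close>

lemma no_zero_same_sign:
  fixes h :: "real \<Rightarrow> real"
  assumes "continuous_on {p<..<q} h" "\<And>x. p < x \<Longrightarrow> x < q \<Longrightarrow> h x \<noteq> 0"
    and "p < x" "x < q" "p < y" "y < q"
  shows "0 < h x * h y"
proof (rule ccontr)
  assume "\<not> ?thesis"
  moreover have "h x \<noteq> 0" "h y \<noteq> 0" using assms by auto
  ultimately have lt: "h x < 0 \<and> 0 < h y \<or> 0 < h x \<and> h y < 0"
    by (metis linorder_less_linear mult_neg_neg mult_pos_pos)
  have "connected (h ` {p<..<q})"
    using assms(1) by (intro connected_continuous_image) auto
  moreover have "h x \<in> h ` {p<..<q}" "h y \<in> h ` {p<..<q}" using assms by auto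
  ultimately have "0 \<in> h ` {p<..<q}"
    using lt unfolding connected_iff_interval by (metis less_imp_le)
  then show False using assms(2) by auto
qed

lemma deriv_sign_at_endpoint:
  fixes h :: "real \<Rightarrow> real"
  assumes "h p = 0"
  shows "(h has_real_derivative d) (at p) \<Longrightarrow> p < q \<Longrightarrow> (\<And>x. p < x \<Longrightarrow> x < q \<Longrightarrow> 0 < h x) \<Longrightarrow> 0 \<le> d"
    and "(h has_real_derivative d) (at p) \<Longrightarrow> q < p \<Longrightarrow> (\<And>x. q < x \<Longrightarrow> x < p \<Longrightarrow> 0 < h x) \<Longrightarrow> d \<le> 0"
proof -
  assume D: "(h has_real_derivative d) (at p)"
  show "0 \<le> d" if "p < q" and pos: "\<And>x. p < x \<Longrightarrow> x < q \<Longrightarrow> 0 < h x"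
  proof (rule ccontr)
    assume "\<not> 0 \<le> d"
    then obtain e where e: "0 < e" "\<And>t. 0 < t \<Longrightarrow> t < e \<Longrightarrow> h (p + t) < h p"
      using DERIV_neg_dec_right[OF D] by auto
    define t where "t = min e (q - p) / 2"
    have "0 < t" "t < e" "p + t < q" using e(1) that(1) by (auto simp: t_def min_def field_simps)
    then show False using e(2)[of t] pos[of "p + t"] assms by auto
  qed
  show "d \<le> 0" if "q < p" and pos: "\<And>x. q < x \<Longrightarrow> x < p \<Longrightarrow> 0 < h x"
  proof (rule ccontr)
    assume "\<not> d \<le> 0"
    then obtain e where e: "0 < e" "\<And>t. 0 < t \<Longrightarrow> t < e \<Longrightarrow> h (p - t) < h p"
      using DERIV_pos_inc_left[OF D] by auto
    define t where "t = min e (p - q) / 2"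
    have "0 < t" "t < e" "q < p - t" using e(1) that(1) by (auto simp: t_def min_def field_simps)
    then show False using e(2)[of t] pos[of "p - t"] assms by auto
  qed
qed

text \<open>If \<open>g\<close> had no zero in between, \<open>f g\<close> would have constant sign
  there and \<open>wr f g\<close> would be strictly monotone, while the conditions at the two
  endpoints force its values into the opposite order. Admitting zeros of the Wronskian as endpoints
  is what later yields strict inequalities between zero counts.\<close>

lemma sturm_separation:
  assumes f: "eigfun \<sigma> u l f" and g: "eigfun \<sigma> u k g" and "l < k" "p < q"
    and p: "f p = 0 \<or> wr f g p = 0" and q: "f q = 0 \<or> wr f g q = 0"
    and nf: "\<And>x. p < x \<Longrightarrow> x < q \<Longrightarrow> f x \<noteq> 0"
  shows "\<exists>x. p < x \<and> x < q \<and> g x = 0"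
proof (rule ccontr)
  assume ng: "\<not> ?thesis"
  define x0 where "x0 = (p + q) / 2"
  \<comment> \<open>Only the sign of \<epsilon> matters: it makes \<open>h\<close> positive on the
    open interval, so that \<open>w\<close> decreases.\<close>
  define \<epsilon> where "\<epsilon> = f x0 * g x0"
  define h where "h x = \<epsilon> * (f x * g x)" for x
  define w where "w x = \<epsilon> * wr f g x" for x
  note sm = eigfunD(1)[OF f] eigfunD(1)[OF g]
  have x0: "p < x0" "x0 < q" using \<open>p < q\<close> by (auto simp: x0_def)
  have cont: "continuous_on {p<..<q} (\<lambda>x. f x * g x)"
    by (intro continuous_intros smooth_cont sm)
  have pos: "0 < h x" if "p < x" "x < q" for x
    using no_zero_same_sign[OF cont, of x0 x] x0 that nf ng by (auto simp: h_def \<epsilon>_def)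
  have Dh: "(h has_real_derivative \<epsilon> * (deriv f x * g x + deriv g x * f x)) (at x)" for x
    unfolding h_def by (intro DERIV_cmult DERIV_mult smooth_DERIV sm)
  have Dw: "(w has_real_derivative (l - k) * h x) (at x)" for x
    unfolding w_def h_def using DERIV_cmult[OF DERIV_wr[OF f g], of \<epsilon>] by (simp add: algebra_simps)
  have "w q < w p"
  proof (rule DERIV_neg_imp_decreasing_open[OF \<open>p < q\<close>])
    show "\<exists>y. DERIV w x :> y \<and> y < 0" if "p < x" "x < q" for x
      using Dw pos[OF that] \<open>l < k\<close> by (intro exI[of _ "(l - k) * h x"]) (auto simp: mult_neg_pos)
    show "continuous_on {p..q} w"
      by (meson Dw DERIV_isCont continuous_at_imp_continuous_on)
  qed
  moreover have "w p \<le> 0"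
  proof (cases "f p = 0")
    case True
    \<comment> \<open>At a zero of \<open>f\<close> the derivative of \<open>h\<close> equals
      \<open>- w\<close>, so the one-sided sign of \<open>h\<close> decides the sign of
      \<open>w p\<close>.\<close>
    then have "0 \<le> \<epsilon> * (deriv f p * g p + deriv g p * f p)"
      using pos \<open>p < q\<close> by (intro deriv_sign_at_endpoint(1)[of h p _ q] Dh) (auto simp: h_def)
    then show ?thesis using True by (simp add: w_def wr_def algebra_simps)
  qed (use p in \<open>simp add: w_def\<close>)
  moreover have "0 \<le> w q"
  proof (cases "f q = 0")
    case True
    then have "\<epsilon> * (deriv f q * g q + deriv g q * f q) \<le> 0"
      using pos \<open>p < q\<close> by (intro deriv_sign_at_endpoint(2)[of h q _ p] Dh) (auto simp: h_def)
    then show ?thesis using True by (simp add: w_def wr_def algebra_simps)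
  qed (use q in \<open>simp add: w_def\<close>)
  ultimately show False by simp
qed

section \<open>Zeros in a half-open window of length pi\<close>

definition zeros :: "(real \<Rightarrow> real) \<Rightarrow> real \<Rightarrow> real set" where
  "zeros f a = {x \<in> {a..<a + pi}. f x = 0}"

definition zcount :: "(real \<Rightarrow> real) \<Rightarrow> nat" where
  "zcount f = card (zeros f 0)"

text \<open>An accumulation point of zeros would be a zero of both \<open>f\<close> and
  \<open>deriv f\<close>.\<close>

lemma finite_zeros:
  assumes "eigfun \<sigma> u l f"
  shows "finite (zeros f a)"
proof (rule ccontr)
  assume "infinite (zeros f a)"
  then have "infinite {x \<in> {a..a + pi}. f x = 0}"
    by (rule infinite_super[rotated]) (auto simp: zeros_def)
  then obtain z where z: "z islimpt {x \<in> {a..a + pi}. f x = 0}"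
    using compact_eq_Bolzano_Weierstrass[of "{a..a + pi}"] islimpt_subset
    by (metis (no_types, lifting) compact_Icc mem_Collect_eq subsetI)
  have cont: "isCont f z" using DERIV_isCont smooth_DERIV eigfunD(1)[OF assms] by blast
  have ev: "\<exists>\<^sub>F x in at z. f x = 0"
    using z unfolding islimpt_iff_eventually frequently_def
    by (rule contrapos_nn) (auto elim: eventually_mono)
  have fz: "f z = 0"
  proof (rule ccontr)
    assume "f z \<noteq> 0"
    then have "\<forall>\<^sub>F x in at z. f x \<noteq> 0"
      using cont tendsto_imp_eventually_ne unfolding isCont_def by blast
    then show False using ev by (simp add: frequently_def)
  qed
  have "((\<lambda>y. (f y - f z) / (y - z)) \<longlongrightarrow> deriv f z) (at z)"
    using smooth_DERIV[OF eigfunD(1)[OF assms], of z] by (simp add: has_field_derivative_iff)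
  moreover have "deriv f z \<noteq> 0" using eigfunD(4)[OF assms, of z] fz by simp
  ultimately have "\<forall>\<^sub>F y in at z. (f y - f z) / (y - z) \<noteq> 0"
    by (rule tendsto_imp_eventually_ne)
  then have "\<forall>\<^sub>F y in at z. f y \<noteq> 0" by (rule eventually_mono) (auto simp: fz)
  then show False using ev by (simp add: frequently_def)
qed

lemma zero_shift_iff:
  assumes "\<And>x. f (x + pi) = \<sigma> * f x" "\<sigma> * \<sigma> = 1"
  shows "f (x + of_int k * pi) = 0 \<longleftrightarrow> f x = (0 :: real)"
proof -
  have s: "f (x + pi) = 0 \<longleftrightarrow> f x = 0" for x using assms by auto
  have n: "f (x + of_nat n * pi) = 0 \<longleftrightarrow> f x = 0" for n x
  proof (induction n)
    case (Suc n)
    then show ?case using s[of "x + of_nat n * pi"] by (simp add: algebra_simps)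
  qed simp
  show ?thesis
  proof (cases k)
    case (nonneg n)
    then show ?thesis using n[of x n] by simp
  next
    case (neg n)
    then have k: "real_of_int k = - real (Suc n)" by simp
    have e: "x + of_int k * pi + of_nat (Suc n) * pi = x" unfolding k by (simp add: algebra_simps)
    show ?thesis using n[of "x + of_int k * pi" "Suc n"] unfolding e by blast
  qed
qed

lemma card_zeros_le:
  assumes f: "eigfun \<sigma> u l f" "\<sigma> * \<sigma> = 1"
  shows "card (zeros f a) \<le> card (zeros f b)"
proof (rule card_inj_on_le[OF _ _ finite_zeros[OF f(1)]])
  \<comment> \<open>Translation by a multiple of pi into the window that starts at
    \<open>b\<close>.\<close>
  define r where "r x = x - of_int \<lfloor>(x - b) / pi\<rfloor> * pi" for x
  show "r ` zeros f a \<subseteq> zeros f b"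
  proof safe
    fix x assume x: "x \<in> zeros f a"
    have "f (r x) = 0"
      using zero_shift_iff[of f \<sigma> "r x" "\<lfloor>(x - b) / pi\<rfloor>"] x eigfunD(2)[OF f(1)] f(2)
      by (auto simp: r_def zeros_def)
    moreover have "of_int \<lfloor>(x - b) / pi\<rfloor> * pi \<le> x - b"
      using of_int_floor_le[of "(x - b) / pi"] pos_le_divide_eq[OF pi_gt_zero] by blast
    moreover have "x - b < (of_int \<lfloor>(x - b) / pi\<rfloor> + 1) * pi"
      using real_of_int_floor_add_one_gt[of "(x - b) / pi"] pos_divide_less_eq[OF pi_gt_zero] by blast
    ultimately have "f (r x) = 0" "b \<le> r x" "r x < b + pi"
      by (simp_all add: r_def algebra_simps)
    then show "r x \<in> zeros f b" by (simp add: zeros_def)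
  qed
  show "inj_on r (zeros f a)"
  proof (rule inj_onI)
    fix x y assume x: "x \<in> zeros f a" "y \<in> zeros f a" "r x = r y"
    define k where "k = \<lfloor>(x - b) / pi\<rfloor> - \<lfloor>(y - b) / pi\<rfloor>"
    have k: "x - y = of_int k * pi" using x(3) by (simp add: k_def r_def algebra_simps)
    have "\<bar>x - y\<bar> < pi" using x by (auto simp: zeros_def)
    then have "\<bar>of_int k\<bar> * pi < 1 * pi" unfolding k abs_mult by simp
    then have "\<bar>of_int k :: real\<bar> < 1" by (simp add: mult_less_cancel_right)
    then have "k = 0" by linarith
    then show "x = y" using k by simp
  qed
qed

lemma card_zeros:
  "eigfun \<sigma> u l f \<Longrightarrow> \<sigma> * \<sigma> = 1 \<Longrightarrow> card (zeros f a) = zcount f"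
  unfolding zcount_def using card_zeros_le by (metis order_antisym)

text \<open>The marked points \<open>S\<close> cut one period into \<open>card S\<close> gaps, each
  containing a zero of \<open>g\<close> by Sturm separation. Marking \<open>a\<close> itself closes
  the last gap, because \<open>a + pi\<close> then satisfies the endpoint condition by
  periodicity.\<close>

lemma sturm_count:
  assumes f: "eigfun \<sigma> u l f" and g: "eigfun \<sigma> u k g" and \<sigma>: "\<sigma> * \<sigma> = 1" and "l < k"
    and S: "finite S" "S \<subseteq> {a..<a + pi}" "a \<in> S"
    and z: "\<And>x. x \<in> S \<Longrightarrow> f x = 0 \<or> wr f g x = 0"
    and nz: "\<And>x. x \<in> {a..<a + pi} - S \<Longrightarrow> f x \<noteq> 0"
  shows "card S \<le> card (zeros g a - S)"
proof -
  \<comment> \<open>The successor of \<open>p\<close> among the marked points, with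
    \<open>a + pi\<close> following the last one.\<close>
  define nxt where "nxt p = Min (insert (a + pi) {q \<in> S. p < q})" for p
  have fin: "finite (insert (a + pi) {q \<in> S. p < q})" for p using S(1) by auto
  have nxt_le: "nxt p \<le> q" if "q \<in> S" "p < q" for p q
    unfolding nxt_def using fin that by (intro Min_le) auto
  have nxt_le_end: "nxt p \<le> a + pi" for p
    unfolding nxt_def using fin by (intro Min_le) auto
  have nxt_in: "nxt p \<in> insert (a + pi) {q \<in> S. p < q}" for p
    unfolding nxt_def using fin by (intro Min_in) auto
  have "\<exists>x. p < x \<and> x < nxt p \<and> g x = 0" if "p \<in> S" for p
  proof (rule sturm_separation[OF f g \<open>l < k\<close>])
    show "p < nxt p" using nxt_in[of p] that S(2) by auto
    show "f p = 0 \<or> wr f g p = 0" using z that .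
    have "f (a + pi) = 0 \<or> wr f g (a + pi) = 0"
      using z[OF S(3)] eigfunD(2)[OF f, of a] wr_shift[OF f g \<sigma>, of a] by auto
    then show "f (nxt p) = 0 \<or> wr f g (nxt p) = 0" using nxt_in[of p] z by auto
    show "f x \<noteq> 0" if "p < x" "x < nxt p" for x
      using nxt_le[of x p] nxt_le_end[of p] that \<open>p \<in> S\<close> S(2) by (intro nz) auto
  qed
  then obtain h where h: "\<And>p. p \<in> S \<Longrightarrow> p < h p \<and> h p < nxt p \<and> g (h p) = 0" by metis
  have "h p \<notin> S" if "p \<in> S" for p
    using h[OF that] nxt_le[of "h p" p] by auto
  moreover have "h p \<in> zeros g a" if "p \<in> S" for p
    using h[OF that] S(2) that nxt_le_end[of p] by (auto simp: zeros_def)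
  ultimately have "h ` S \<subseteq> zeros g a - S" by auto
  moreover have "inj_on h S"
  proof (rule linorder_inj_onI)
    show "h p \<noteq> h q" if "p < q" "p \<in> S" "q \<in> S" for p q
      using h[OF that(2)] h[OF that(3)] nxt_le[OF that(3,1)] by auto
  qed auto
  ultimately show ?thesis
    using finite_zeros[OF g] by (intro card_inj_on_le[of h]) auto
qed

text \<open>The zero \<open>a\<close> of the Wronskian is marked along with the zeros of
  \<open>f\<close>. If \<open>f a\<close> is nonzero, this adds a gap. Otherwise \<open>a\<close> is
  a common zero, which is marked and hence comes on top of the zeros of \<open>g\<close> found in
  the gaps.\<close>

lemma zcount_strict_mono:
  assumes f: "eigfun \<sigma> u l f" and g: "eigfun \<sigma> u k g" and \<sigma>: "\<sigma> * \<sigma> = 1" and "l < k"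
    and a: "wr f g a = 0"
  shows "zcount f < zcount g"
proof -
  define S where "S = insert a (zeros f a)"
  have fin: "finite (zeros f a)" "finite (zeros g a)"
    using finite_zeros f g by blast+
  have le: "card S \<le> card (zeros g a - S)"
    using a by (intro sturm_count[OF f g \<sigma> \<open>l < k\<close>]) (auto simp: S_def fin, auto simp: zeros_def)
  show ?thesis
  proof (cases "f a = 0")
    case True
    then have "g a = 0" using a eigfunD(4)[OF f, of a] by (auto simp: wr_def)
    then have "a \<in> zeros g a" by (simp add: zeros_def)
    then have "zeros g a - S \<subset> zeros g a" by (auto simp: S_def)
    then have "card (zeros g a - S) < card (zeros g a)" using fin by (intro psubset_card_mono)
    moreover have "S = zeros f a" using True by (auto simp: S_def zeros_def)
    ultimately show ?thesis using le card_zeros[OF f \<sigma>, of a] card_zeros[OF g \<sigma>, of a] by simp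
  next
    case False
    then have "card S = Suc (card (zeros f a))" using fin by (simp add: S_def zeros_def)
    moreover have "card (zeros g a - S) \<le> card (zeros g a)" using fin by (intro card_mono) auto
    ultimately show ?thesis using le card_zeros[OF f \<sigma>, of a] card_zeros[OF g \<sigma>, of a] by linarith
  qed
qed

lemma zcount_mono:
  assumes f: "eigfun \<sigma> u l f" and g: "eigfun \<sigma> u k g" and \<sigma>: "\<sigma> * \<sigma> = 1" and "l < k"
  shows "zcount f \<le> zcount g"
proof (cases "zeros f 0 = {}")
  case False
  then obtain a where a: "f a = 0" by (auto simp: zeros_def)
  have "card (zeros f a) \<le> card (zeros g a - zeros f a)"
    using a finite_zeros[OF f] by (intro sturm_count[OF f g \<sigma> \<open>l < k\<close>]) (auto simp: zeros_def)
  also have "\<dots> \<le> card (zeros g a)" using finite_zeros[OF g] by (intro card_mono) auto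
  finally show ?thesis using card_zeros[OF f \<sigma>] card_zeros[OF g \<sigma>] by metis
qed (simp add: zcount_def)

lemma zcount_0D: "eigfun \<sigma> u l f \<Longrightarrow> \<sigma> * \<sigma> = 1 \<Longrightarrow> zcount f = 0 \<Longrightarrow> f x \<noteq> 0"
  using card_zeros[of \<sigma> u l f x] finite_zeros[of \<sigma> u l f x] by (auto simp: zeros_def)

text \<open>Otherwise neither function has a zero, so \<open>wr f g\<close> has a derivative without
  zeros; this contradicts its periodicity.\<close>

lemma zcount_pos:
  assumes f: "eigfun \<sigma> u l f" and g: "eigfun \<sigma> u k g" and \<sigma>: "\<sigma> * \<sigma> = 1" and "l < k"
  shows "0 < zcount g"
proof (rule ccontr)
  assume g0: "\<not> 0 < zcount g"
  then have f0: "zcount f = 0" using zcount_mono[OF assms] by simp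
  obtain x where "(l - k) * (f x * g x) = 0"
    using MVT2[of 0 pi "wr f g" "\<lambda>x. (l - k) * (f x * g x)"] DERIV_wr[OF f g]
      wr_shift[OF f g \<sigma>, of 0] by auto
  then show False using zcount_0D[OF f \<sigma> f0] zcount_0D[OF g \<sigma>] g0 \<open>l < k\<close> by auto
qed

text \<open>Each simple zero flips the sign. The induction moves the left endpoint just past the
  leftmost zero.\<close>

lemma sign_change_parity:
  fixes f :: "real \<Rightarrow> real"
  assumes "smooth f" "\<And>x. f x \<noteq> 0 \<or> deriv f x \<noteq> 0"
    and "finite {x. a < x \<and> x < b \<and> f x = 0}" "card {x. a < x \<and> x < b \<and> f x = 0} = n"
    and "a < b" "f a \<noteq> 0" "f b \<noteq> 0"
  shows "0 < (- 1) ^ n * (f a * f b)"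
  using assms(3-)
proof (induction n arbitrary: a)
  case 0
  then have nz: "f x \<noteq> 0" if "a \<le> x" "x \<le> b" for x
    using that by (metis (mono_tags, lifting) card_0_eq empty_iff mem_Collect_eq order_le_less)
  show ?case
  proof (rule ccontr)
    assume "\<not> ?thesis"
    then have "f a \<le> 0 \<and> 0 \<le> f b \<or> 0 \<le> f a \<and> f b \<le> 0"
      by (auto simp: zero_less_mult_iff)
    then show False
      using IVT'[of f a 0 b] IVT2'[of f b 0 a] nz \<open>a < b\<close> smooth_cont[OF assms(1)] by (metis less_imp_le)
  qed
next
  case (Suc n)
  define A where "A = {x. a < x \<and> x < b \<and> f x = 0}"
  have cA: "card A = Suc n" using Suc.prems by (simp add: A_def)
  have A: "finite A" "A \<noteq> {}" using Suc.prems cA by (simp add: A_def, force)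
  define z where "z = Min A"
  have z: "a < z" "z < b" "f z = 0" using Min_in[OF A] by (auto simp: A_def z_def)
  have zmin: "z \<le> x" if "x \<in> A" for x using A that by (simp add: z_def)
  have D: "((\<lambda>x. f a * f x) has_real_derivative f a * deriv f z) (at z)"
    by (intro DERIV_cmult smooth_DERIV assms(1))
  have left: "0 < f a * f x" if "a < x" "x < z" for x
  proof (rule ccontr)
    assume "\<not> ?thesis"
    then have "f a \<le> 0 \<and> 0 \<le> f x \<or> 0 \<le> f a \<and> f x \<le> 0"
      using Suc.prems by (auto simp: zero_less_mult_iff)
    then obtain y where "a \<le> y" "y \<le> x" "f y = 0"
      using IVT'[of f a 0 x] IVT2'[of f x 0 a] \<open>a < x\<close> smooth_cont[OF assms(1)] by (metis less_imp_le)
    then have "y \<in> A" "y < z" using that z Suc.prems by (auto simp: A_def order_le_less)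
    then show False using zmin by fastforce
  qed
  have "f a * deriv f z \<le> 0"
    using z left by (intro deriv_sign_at_endpoint(2)[OF _ D, of a]) auto
  then have neg: "f a * deriv f z < 0" using assms(2)[of z] z Suc.prems by (simp add: order_le_less)
  obtain e where e: "0 < e" "\<And>t. 0 < t \<Longrightarrow> t < e \<Longrightarrow> f a * f (z + t) < 0"
    using DERIV_neg_dec_right[OF D neg] z by auto
  define y where "y = Min (insert b (A - {z}))"
  have y: "z < y"
    unfolding y_def using A z zmin by (subst Min_gr_iff) (auto simp: order_le_less)
  have y_le: "y \<le> x" if "x \<in> insert b (A - {z})" for x
    unfolding y_def using A that by (intro Min_le) auto
  \<comment> \<open>Close enough to \<open>z\<close> for the sign to be opposite to that at
    \<open>a\<close>, and still before the next zero.\<close>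
  define c where "c = z + min e (y - z) / 2"
  have c: "z < c" "c < y" "f a * f c < 0"
    using e(1) e(2)[of "min e (y - z) / 2"] y by (auto simp: c_def min_def field_simps)
  have cb: "c < b" using c y_le by force
  have eq: "{x. c < x \<and> x < b \<and> f x = 0} = A - {z}"
    using c z y_le by (force simp: A_def)
  have "card (A - {z}) = n" using Suc.prems z A by (simp add: A_def)
  then have IH: "0 < (- 1) ^ n * (f c * f b)"
    using Suc.prems A c cb by (intro Suc.IH) (auto simp: eq)
  have "0 < (- 1) ^ n * (f c * f b) * (- (f a * f c))"
    by (rule mult_pos_pos[OF IH]) (use c(3) in simp)
  also have "\<dots> = (- 1) ^ Suc n * (f a * f b) * (f c)\<^sup>2"
    by (simp add: power2_eq_square)
  finally show ?case by (rule zero_less_mult_pos2) (use c(3) in auto)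
qed

text \<open>The zeros in one period are counted from a point \<open>a\<close> with nonzero value,
  and the signs at \<open>a\<close> and \<open>a + pi\<close> differ by the factor \<sigma>.\<close>

lemma zcount_parity:
  assumes f: "eigfun \<sigma> u l f" and \<sigma>: "\<sigma> = 1 \<or> \<sigma> = - 1"
  shows "even (zcount f) \<longleftrightarrow> \<sigma> = 1"
proof -
  have \<sigma>2: "\<sigma> * \<sigma> = 1" using \<sigma> by auto
  obtain a where a: "f a \<noteq> 0"
  proof (cases "\<forall>x. f x = 0")
    case True
    then have "f = (\<lambda>x. 0)" by auto
    then show ?thesis using eigfunD(4)[OF f, of 0] by simp
  qed (use that in auto)
  have "zeros f a = {x. a < x \<and> x < a + pi \<and> f x = 0}"
    using a by (auto simp: zeros_def order_le_less)
  moreover have "f (a + pi) \<noteq> 0" using a eigfunD(2)[OF f, of a] \<sigma> by auto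
  ultimately have "0 < (- 1) ^ zcount f * (f a * f (a + pi))"
    using sign_change_parity[OF eigfunD(1,4)[OF f], of a "a + pi"] a
      card_zeros[OF f \<sigma>2, of a] finite_zeros[OF f, of a] by simp
  also have "\<dots> = (- 1) ^ zcount f * \<sigma> * (f a)\<^sup>2"
    by (simp add: eigfunD(2)[OF f] power2_eq_square)
  finally have "0 < (- 1) ^ zcount f * \<sigma>" by (rule zero_less_mult_pos2) (use a in auto)
  then show ?thesis using \<sigma> by (cases "even (zcount f)") auto
qed

section \<open>Pairs of eigenfunctions with equally many zeros\<close>

text \<open>The quotient below is the difference of the two regularised integrals \<open>\<integral> 1 / g\<^sup>2\<close> (the
  second solutions at the middle eigenvalue) obtained from \<open>f\<close> and from \<open>h\<close>.\<close>

lemma DERIV_wr_quotient: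
  assumes f: "eigfun \<sigma> u l f" and g: "eigfun \<sigma> u k g" and h: "eigfun \<sigma> u m h"
    and P: "wr g f x \<noteq> 0" and Q: "wr g h x \<noteq> 0"
  shows "((\<lambda>x. wr f h x / (wr g f x * wr g h x)) has_real_derivative
     - ((k - l) * (f x * wr g h x)\<^sup>2 + (m - k) * (h x * wr g f x)\<^sup>2) / (wr g f x * wr g h x)\<^sup>2) (at x)"
proof -
  \<comment> \<open>This Pluecker relation eliminates \<open>wr f h\<close> from the numerator and
    leaves a sum of squares with positive weights when \<open>l < k < m\<close>.\<close>
  have plucker: "g x * wr f h x = f x * wr g h x - h x * wr g f x"
    by (simp add: wr_def algebra_simps)
  have "((\<lambda>x. wr f h x / (wr g f x * wr g h x)) has_real_derivative
     ((l - m) * (f x * h x) * (wr g f x * wr g h x) - wr f h x *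
       ((k - l) * (g x * f x) * wr g h x + (k - m) * (g x * h x) * wr g f x))
       / ((wr g f x * wr g h x) * (wr g f x * wr g h x))) (at x)"
    using P Q
    by (intro DERIV_divide DERIV_mult DERIV_wr[OF f h] DERIV_wr[OF g f] DERIV_wr[OF g h]) auto
  also have "(l - m) * (f x * h x) * (wr g f x * wr g h x) - wr f h x *
       ((k - l) * (g x * f x) * wr g h x + (k - m) * (g x * h x) * wr g f x)
     = (l - m) * (f x * h x) * (wr g f x * wr g h x) - (g x * wr f h x) *
       ((k - l) * f x * wr g h x + (k - m) * h x * wr g f x)"
    by (simp add: algebra_simps)
  also have "\<dots> = - ((k - l) * (f x * wr g h x)\<^sup>2 + (m - k) * (h x * wr g f x)\<^sup>2)"
    unfolding plucker by (simp add: algebra_simps power2_eq_square)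
  finally show ?thesis by (simp add: power2_eq_square)
qed

text \<open>If both Wronskians were zero-free, the quotient differentiated above would be defined
  everywhere, periodic and nonincreasing, hence constant on a period. Its vanishing derivative would
  make \<open>f\<close> vanish on an interval.\<close>

lemma wr_not_both_nonzero:
  assumes f: "eigfun \<sigma> u l f" and g: "eigfun \<sigma> u k g" and h: "eigfun \<sigma> u m h"
    and \<sigma>: "\<sigma> * \<sigma> = 1" and lt: "l < k" "k < m"
  shows "\<exists>x. wr f g x = 0 \<or> wr g h x = 0"
proof (rule ccontr)
  assume "\<not> ?thesis"
  moreover have "wr g f x = - wr f g x" for x by (simp add: wr_def)
  ultimately have nz: "wr g f x \<noteq> 0" "wr g h x \<noteq> 0" for x by auto
  define r where "r x = wr f h x / (wr g f x * wr g h x)" for x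
  define d where "d x = - ((k - l) * (f x * wr g h x)\<^sup>2 + (m - k) * (h x * wr g f x)\<^sup>2)
    / (wr g f x * wr g h x)\<^sup>2" for x
  have D: "(r has_real_derivative d x) (at x)" for x
    unfolding r_def d_def by (rule DERIV_wr_quotient[OF f g h nz])
  have "0 \<le> (k - l) * (f x * wr g h x)\<^sup>2 + (m - k) * (h x * wr g f x)\<^sup>2" for x
    using lt by (intro add_nonneg_nonneg mult_nonneg_nonneg) auto
  then have "d x \<le> 0" for x
    unfolding d_def by (intro divide_nonpos_nonneg; simp only: neg_le_0_iff_le zero_le_power2)
  then have antimono: "r y \<le> r x" if "x \<le> y" for x y
    using DERIV_nonpos_imp_nonincreasing[OF that] D by blast
  have "r pi = r 0"
    using wr_shift[OF f h \<sigma>, of 0] wr_shift[OF g f \<sigma>, of 0] wr_shift[OF g h \<sigma>, of 0]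
    by (simp add: r_def)
  then have const: "r x = r 0" if "0 \<le> x" "x \<le> pi" for x
    using antimono[OF that(1)] antimono[OF that(2)] by simp
  have "f x = 0" if x: "0 < x" "x < pi" for x
  proof -
    have "d x = 0"
    proof (rule DERIV_local_const[OF D])
      show "0 < min x (pi - x)" using x by simp
      show "\<forall>y. \<bar>x - y\<bar> < min x (pi - x) \<longrightarrow> r x = r y"
      proof (intro allI impI)
        fix y assume "\<bar>x - y\<bar> < min x (pi - x)"
        then have "0 \<le> y" "y \<le> pi" by (auto simp: abs_if split: if_splits)
        then show "r x = r y" using const[of x] const[of y] x by simp
      qed
    qed
    then have "(k - l) * (f x * wr g h x)\<^sup>2 + (m - k) * (h x * wr g f x)\<^sup>2 = 0"
      using nz[of x] by (simp add: d_def)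
    moreover have "0 \<le> (k - l) * (f x * wr g h x)\<^sup>2" "0 \<le> (m - k) * (h x * wr g f x)\<^sup>2"
      using lt by (intro mult_nonneg_nonneg; simp)+
    ultimately have "(k - l) * (f x * wr g h x)\<^sup>2 = 0" by linarith
    then show ?thesis using nz[of x] lt by simp
  qed
  then have "{0<..<pi} \<subseteq> zeros f 0" by (auto simp: zeros_def)
  then show False
    using finite_zeros[OF f, of 0] finite_subset infinite_Ioo[OF pi_gt_zero] by blast
qed

text \<open>For \<open>e = 0\<close> the functions are periodic and indexed from 0, for \<open>e = 1\<close> they are
  antiperiodic and indexed from 1.\<close>

definition hill_system ::
  "real \<Rightarrow> (real \<Rightarrow> real) \<Rightarrow> nat \<Rightarrow> nat \<Rightarrow> (nat \<Rightarrow> real) \<Rightarrow> (nat \<Rightarrow> real \<Rightarrow> real) \<Rightarrow> bool" where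
  "hill_system \<sigma> u e j \<mu> f \<longleftrightarrow> (\<sigma> = 1 \<and> e = 0 \<or> \<sigma> = - 1 \<and> e = 1) \<and>
     strict_mono_on {e..2 * j} \<mu> \<and> (\<forall>i \<in> {e..2 * j}. eigfun \<sigma> u (\<mu> i) (f i)) \<and>
     zcount (f (2 * j)) + e \<le> 2 * j"

context
  fixes \<sigma> u e j \<mu> f
  assumes sys: "hill_system \<sigma> u e j \<mu> f"
begin

section \<open>Zero counts along a Hill system\<close>

lemma \<sigma>_cases: "\<sigma> = 1 \<and> e = 0 \<or> \<sigma> = - 1 \<and> e = 1"
  and \<sigma>_square: "\<sigma> * \<sigma> = 1"
  and eig: "i \<in> {e..2 * j} \<Longrightarrow> eigfun \<sigma> u (\<mu> i) (f i)"
  and \<mu>_less: "i \<in> {e..2 * j} \<Longrightarrow> k \<in> {e..2 * j} \<Longrightarrow> i < k \<Longrightarrow> \<mu> i < \<mu> k"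
  and zcount_top: "zcount (f (2 * j)) + e \<le> 2 * j"
  using sys by (auto simp: hill_system_def strict_mono_on_def)

text \<open>Adding \<open>e\<close> makes the count even in the periodic and the antiperiodic case
  alike.\<close>

lemma even_zcount: "i \<in> {e..2 * j} \<Longrightarrow> even (zcount (f i) + e)"
  using zcount_parity[OF eig, of i] \<sigma>_cases by auto

lemma zcount_Suc:
  assumes "e \<le> i" "Suc i \<le> 2 * j"
  shows "zcount (f i) \<le> zcount (f (Suc i))"
    and "wr (f i) (f (Suc i)) x = 0 \<Longrightarrow> zcount (f i) + 2 \<le> zcount (f (Suc i))"
proof -
  note E = eig[of i] eig[of "Suc i"] and lt = \<mu>_less[of i "Suc i"]
  show "zcount (f i) \<le> zcount (f (Suc i))"
    using assms by (intro zcount_mono[OF E \<sigma>_square lt]) auto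
  assume 0: "wr (f i) (f (Suc i)) x = 0"
  have "zcount (f i) < zcount (f (Suc i))"
    using assms by (intro zcount_strict_mono[OF E \<sigma>_square lt 0]) auto
  moreover have "even (zcount (f i) + e)" "even (zcount (f (Suc i)) + e)"
    using assms by (auto intro!: even_zcount simp del: even_add)
  moreover have "p + 2 \<le> q" if "p < q" "even (p + r)" "even (q + r)" for p q r :: nat
    using that by presburger
  ultimately show "zcount (f i) + 2 \<le> zcount (f (Suc i))" by blast
qed

text \<open>One of the two neighbouring Wronskians vanishes somewhere, and parity raises the
  resulting strict increase to at least two.\<close>

lemma zcount_Suc_Suc:
  assumes "e \<le> i" "Suc (Suc i) \<le> 2 * j"
  shows "zcount (f i) + 2 \<le> zcount (f (Suc (Suc i)))"
proof -
  obtain x where "wr (f i) (f (Suc i)) x = 0 \<or> wr (f (Suc i)) (f (Suc (Suc i))) x = 0"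
    using wr_not_both_nonzero[OF eig[of i] eig[of "Suc i"] eig[of "Suc (Suc i)"] \<sigma>_square
      \<mu>_less[of i "Suc i"] \<mu>_less[of "Suc i" "Suc (Suc i)"]] assms by auto
  then show ?thesis
    using zcount_Suc(1)[of i] zcount_Suc(2)[of i x] zcount_Suc(1)[of "Suc i"]
      zcount_Suc(2)[of "Suc i" x] assms by auto
qed

text \<open>The lower bound climbs from index 1. There it comes from \<open>zcount_pos\<close> and
  parity if \<open>e = 0\<close>, and from parity alone if \<open>e = 1\<close>.\<close>

lemma zcount_odd_ge:
  assumes "Suc l \<le> j"
  shows "2 * Suc l \<le> zcount (f (Suc (2 * l))) + e"
  using assms
proof (induction l)
  case 0
  have "0 < zcount (f 1) + e"
  proof (cases "e = 0")
    case True
    then show ?thesis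
      using zcount_pos[OF eig[of 0] eig[of 1] \<sigma>_square \<mu>_less[of 0 1]] 0 by simp
  qed simp
  moreover have "even (zcount (f 1) + e)" using 0 \<sigma>_cases by (intro even_zcount) auto
  ultimately show ?case by simp presburger
next
  case (Suc l)
  then show ?case using zcount_Suc_Suc[of "Suc (2 * l)"] \<sigma>_cases by auto
qed

text \<open>The upper bound descends from the bound on the top function, losing at least two zeros
  for every two indices.\<close>

lemma zcount_even_le:
  assumes "l \<le> j" "e \<le> 2 * l"
  shows "zcount (f (2 * l)) + e \<le> 2 * l"
  using assms
proof (induction "j - l" arbitrary: l)
  case 0
  then show ?case using zcount_top by auto
next
  case (Suc d)
  have "zcount (f (2 * Suc l)) + e \<le> 2 * Suc l"
    using Suc(2-) by (intro Suc(1)) auto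
  moreover have "zcount (f (2 * l)) + 2 \<le> zcount (f (2 * Suc l))"
    using zcount_Suc_Suc[of "2 * l"] Suc(2-) by simp
  ultimately show ?case by simp
qed

text \<open>A zero would force a jump by two inside the cluster, but the lower bound for the odd
  index meets the upper bound for the even one.\<close>

lemma pair_wr_nonzero:
  assumes "Suc l \<le> j"
  shows "wr (f (Suc (2 * l))) (f (2 * Suc l)) x \<noteq> 0"
proof
  assume "wr (f (Suc (2 * l))) (f (2 * Suc l)) x = 0"
  then have "zcount (f (Suc (2 * l))) + 2 \<le> zcount (f (2 * Suc l))"
    using zcount_Suc(2)[of "Suc (2 * l)" x] assms \<sigma>_cases by auto
  then show False
    using zcount_odd_ge[OF assms] zcount_even_le[of "Suc l"] assms \<sigma>_cases by auto
qed

lemma pair_zcount_le: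
  assumes "Suc l \<le> j"
  shows "zcount (f (Suc (2 * l))) + e \<le> 2 * Suc l"
  using zcount_Suc(1)[of "Suc (2 * l)"] zcount_even_le[of "Suc l"] assms \<sigma>_cases by auto

text \<open>The system is cut off above the chosen cluster, so the swapped pair sits on top. The new
  top function \<open>a / W\<close> has the zeros of \<open>a\<close>, which keeps the bound
  required of a Hill system.\<close>

lemma hill_system_darboux:
  assumes l: "Suc l \<le> j"
  defines "a \<equiv> f (Suc (2 * l))" and "b \<equiv> f (2 * Suc l)"
  defines "g \<equiv> \<lambda>i. if i = Suc (2 * l) then \<lambda>x. b x / wr a b x
    else if i = 2 * Suc l then \<lambda>x. a x / wr a b x else darboux a b (f i)"
  shows "hill_system \<sigma> (darboux_potential u (wr a b)) e (Suc l) \<mu> g"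
proof -
  have ab: "eigfun \<sigma> u (\<mu> (Suc (2 * l))) a" "eigfun \<sigma> u (\<mu> (2 * Suc l)) b"
    unfolding a_def b_def using l \<sigma>_cases by (intro eig; force)+
  have nz: "wr a b x \<noteq> 0" for x
    unfolding a_def b_def by (rule pair_wr_nonzero[OF l])
  have "eigfun \<sigma> (darboux_potential u (wr a b)) (\<mu> i) (g i)" if i: "i \<in> {e..2 * Suc l}" for i
  proof (cases "i = Suc (2 * l) \<or> i = 2 * Suc l")
    case True
    then show ?thesis using eigfun_darboux_swap[OF \<sigma>_square ab nz] by (auto simp: g_def)
  next
    case False
    have "\<mu> i < \<mu> (Suc (2 * l))" "\<mu> i < \<mu> (2 * Suc l)"
      using i l False \<sigma>_cases by (intro \<mu>_less; force)+
    moreover have "eigfun \<sigma> u (\<mu> i) (f i)" using i l by (intro eig) auto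
    ultimately have "eigfun \<sigma> (darboux_potential u (wr a b)) (\<mu> i) (darboux a b (f i))"
      by (intro eigfun_darboux[OF \<sigma>_square ab nz]) auto
    then show ?thesis using False by (simp add: g_def)
  qed
  moreover have "zcount (g (2 * Suc l)) = zcount a"
    using nz by (simp add: g_def zcount_def zeros_def)
  moreover have "strict_mono_on {e..2 * Suc l} \<mu>"
    using l \<mu>_less by (auto simp: strict_mono_on_def)
  ultimately show ?thesis
    using pair_zcount_le[OF l] \<sigma>_cases unfolding hill_system_def a_def by simp
qed

end

text \<open>Induction over the clusters from the top: the Darboux transform by the highest cluster
  in \<open>I\<close> removes two terms and costs at most two orders of vanishing, while the
  remaining coefficients are unchanged. Once these are known to be zero, the coefficients of the
  cluster itself follow from its zero-free Wronskian.\<close>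

lemma lincomb_zero:
  assumes "hill_system \<sigma> u e j \<mu> f" and "I \<subseteq> {e..2 * j}"
    and "\<And>l. Suc l \<le> j \<Longrightarrow> Suc (2 * l) \<in> I \<longleftrightarrow> 2 * Suc l \<in> I"
    and "vanishes (card I) (\<lambda>x. \<Sum>i\<in>I. c i * f i x) x0" and "i \<in> I"
  shows "c i = 0"
  using assms
proof (induction "card I" arbitrary: I u j f i rule: less_induct)
  case less
  note sys = less.prems(1) and I = less.prems(2,3) and van = less.prems(4)
  have fin: "finite I" using I(1) finite_subset by blast
  show ?case
  proof (cases "I = {0}")
    case True
    then have e: "e = 0" using I(1) by auto
    \<comment> \<open>The only nonempty admissible set without a two-element cluster is
      \<open>{0}\<close>, and the ground state has no zeros.\<close>
    have "zcount (f 0) = 0" using zcount_even_le[OF sys, of 0] e by simp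
    then have "f 0 x0 \<noteq> 0"
      using zcount_0D[OF eig[OF sys, of 0] \<sigma>_square[OF sys]] e by simp
    moreover have "c 0 * f 0 x0 = 0" using van True by (simp add: vanishes_Suc)
    ultimately show ?thesis using less.prems(5) True by simp
  next
    case False
    define M where "M = Max I"
    have M: "M \<in> I" "\<And>k. k \<in> I \<Longrightarrow> k \<le> M"
      unfolding M_def using fin less.prems(5) by (blast intro: Max_in, simp)
    have "M \<noteq> 0"
    proof
      assume "M = 0"
      then have "I \<subseteq> {0}" using M(2) by auto
      then show False using False M(1) by auto
    qed
    \<comment> \<open>The highest cluster is \<open>{2 * l + 1, 2 * l + 2}\<close>, whichever of its
      members \<open>M\<close> is.\<close>
    define l where "l = (M - 1) div 2"
    have Ml: "M = Suc (2 * l) \<or> M = 2 * Suc l" using \<open>M \<noteq> 0\<close> unfolding l_def by presburger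
    have l: "Suc l \<le> j" using M(1) I(1) Ml by auto
    have in_I: "Suc (2 * l) \<in> I" "2 * Suc l \<in> I" using Ml M(1) I(2)[OF l] by auto
    have I_le: "I \<subseteq> {e..2 * Suc l}" using M(2) Ml I(1) by force
    define a where "a = f (Suc (2 * l))"
    define b where "b = f (2 * Suc l)"
    define g where "g = (\<lambda>i. if i = Suc (2 * l) then \<lambda>x. b x / wr a b x
      else if i = 2 * Suc l then \<lambda>x. a x / wr a b x else darboux a b (f i))"
    define J where "J = I - {Suc (2 * l), 2 * Suc l}"
    have sys': "hill_system \<sigma> (darboux_potential u (wr a b)) e (Suc l) \<mu> g"
      unfolding g_def a_def b_def by (rule hill_system_darboux[OF sys l])
    have ab: "eigfun \<sigma> u (\<mu> (Suc (2 * l))) a" "eigfun \<sigma> u (\<mu> (2 * Suc l)) b"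
      unfolding a_def b_def using in_I I by (intro eig[OF sys]; blast)+
    have nz: "wr a b x \<noteq> 0" for x
      unfolding a_def b_def by (rule pair_wr_nonzero[OF sys l])
    have sm: "smooth (f k)" if "k \<in> I" for k
      using eigfunD(1)[OF eig[OF sys]] I(1) that by blast
    have I_eq: "I = insert (Suc (2 * l)) (insert (2 * Suc l) J)" using in_I by (auto simp: J_def)
    have J: "Suc (2 * l) \<notin> J" "2 * Suc l \<notin> J" "finite J" using fin by (auto simp: J_def)
    have card: "card I = Suc (Suc (card J))"
      unfolding I_eq using J by simp
    have "darboux a b (\<lambda>x. \<Sum>k\<in>I. c k * f k x) = (\<lambda>x. \<Sum>k\<in>I. c k * darboux a b (f k) x)"
      by (rule darboux_lincomb[OF sm])
    also have "\<dots> = (\<lambda>x. \<Sum>k\<in>J. c k * g k x)"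
    proof
      fix x
      have "(\<Sum>k\<in>I. c k * darboux a b (f k) x) = (\<Sum>k\<in>J. c k * darboux a b (f k) x)"
        using darboux_annihilates[OF \<sigma>_square[OF sys] ab nz, of x] fin in_I
        by (intro sum.mono_neutral_right) (auto simp: J_def a_def b_def)
      also have "\<dots> = (\<Sum>k\<in>J. c k * g k x)"
        by (rule sum.cong) (auto simp: J_def g_def)
      finally show "(\<Sum>k\<in>I. c k * darboux a b (f k) x) = (\<Sum>k\<in>J. c k * g k x)" .
    qed
    finally have "vanishes (card J) (\<lambda>x. \<Sum>k\<in>J. c k * g k x) x0"
      using vanishes_darboux[OF \<sigma>_square[OF sys] ab nz, of "\<lambda>x. \<Sum>k\<in>I. c k * f k x" "card J" x0]
        van sm by (simp add: card smooth_intros)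
    moreover have "Suc (2 * m) \<in> J \<longleftrightarrow> 2 * Suc m \<in> J" if "Suc m \<le> Suc l" for m
      using I(2)[of m] that l by (auto simp: J_def)
    ultimately have cJ: "c k = 0" if "k \<in> J" for k
      using less.hyps[OF _ sys', of J] I_le card that by (auto simp: J_def)
    have "(\<lambda>x. \<Sum>k\<in>I. c k * f k x) = (\<lambda>x. c (Suc (2 * l)) * a x + c (2 * Suc l) * b x)"
    proof
      fix x
      have "(\<Sum>k\<in>J. c k * f k x) = 0" using cJ by (intro sum.neutral) auto
      then show "(\<Sum>k\<in>I. c k * f k x) = c (Suc (2 * l)) * a x + c (2 * Suc l) * b x"
        unfolding I_eq a_def b_def using J
        by simp
    qed
    moreover have "deriv (\<lambda>x. c (Suc (2 * l)) * a x + c (2 * Suc l) * b x)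
        = (\<lambda>x. c (Suc (2 * l)) * deriv a x + c (2 * Suc l) * deriv b x)"
      by (intro deriv_eqI DERIV_add DERIV_cmult smooth_DERIV eigfunD(1)[OF ab(1)] eigfunD(1)[OF ab(2)])
    ultimately have 0: "c (Suc (2 * l)) * a x0 + c (2 * Suc l) * b x0 = 0"
      "c (Suc (2 * l)) * deriv a x0 + c (2 * Suc l) * deriv b x0 = 0"
      using van by (auto simp: card vanishes_Suc)
    \<comment> \<open>Cramer's rule for the value and the first derivative at
      \<open>x0\<close>.\<close>
    have "c (Suc (2 * l)) * wr a b x0
        = deriv b x0 * (c (Suc (2 * l)) * a x0 + c (2 * Suc l) * b x0)
         - b x0 * (c (Suc (2 * l)) * deriv a x0 + c (2 * Suc l) * deriv b x0)"
      "c (2 * Suc l) * wr a b x0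
        = a x0 * (c (Suc (2 * l)) * deriv a x0 + c (2 * Suc l) * deriv b x0)
         - deriv a x0 * (c (Suc (2 * l)) * a x0 + c (2 * Suc l) * b x0)"
      by (simp_all add: wr_def algebra_simps)
    then have "c (Suc (2 * l)) = 0" "c (2 * Suc l) = 0" using nz[of x0] 0 by auto
    then show ?thesis using cJ less.prems(5) by (auto simp: I_eq)
  qed
qed

section \<open>Trigonometric polynomials\<close>

text \<open>Both parities of \<open>s\<close> are treated at once: the frequencies are the
  \<open>k < s\<close> with the parity of \<open>s - 1\<close>, the constants arising from
  \<open>k = 0\<close>.\<close>

lemma trig_space_induct [consumes 2, case_names cos sin add scale]:
  assumes s: "1 \<le> s" and f: "f \<in> trig_space s"
    and cos: "\<And>k. k < s \<Longrightarrow> even (s - 1 - k) \<Longrightarrow> P (\<lambda>x. cos (real k * x))"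
    and sin: "\<And>k. k < s \<Longrightarrow> even (s - 1 - k) \<Longrightarrow> P (\<lambda>x. sin (real k * x))"
    and add: "\<And>f g. P f \<Longrightarrow> P g \<Longrightarrow> P (\<lambda>x. f x + g x)"
    and scale: "\<And>c f. P f \<Longrightarrow> P (\<lambda>x. c * f x)"
  shows "P f"
proof -
  \<comment> \<open>The zero function, needed for empty sums, is a multiple of the cosine of the top
    frequency \<open>s - 1\<close>, which is always admissible.\<close>
  have "P (\<lambda>x. 0 * cos (real (s - 1) * x))" using s by (intro scale cos) auto
  then have zero: "P (\<lambda>x. 0)" by simp
  have sum: "P (\<lambda>x. \<Sum>j\<in>A. g j x)" if "finite A" "\<And>j. j \<in> A \<Longrightarrow> P (g j)" for A :: "nat set" and g
    using that by (induction rule: finite_induct) (auto intro: zero add)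
  show ?thesis
  proof (cases "odd s")
    case True
    then obtain c a b where "f = (\<lambda>x. c + (\<Sum>j = 1..s div 2.
        a j * cos (2 * real j * x) + b j * sin (2 * real j * x)))"
      using f by (auto simp: trig_space_def)
    then have f_eq: "f = (\<lambda>x. c * cos (real 0 * x) + (\<Sum>j = 1..s div 2.
        a j * cos (real (2 * j) * x) + b j * sin (real (2 * j) * x)))" by simp
    have "2 * j < s \<and> even (s - 1 - 2 * j)" if "j \<in> {1..s div 2}" for j
      using that True s by (auto elim!: oddE)
    then show ?thesis unfolding f_eq using True s by (intro add sum scale cos sin) auto
  next
    case False
    then obtain a b where "f = (\<lambda>x. \<Sum>j = 1..s div 2.
        a j * cos ((2 * real j - 1) * x) + b j * sin ((2 * real j - 1) * x))"
      using f by (auto simp: trig_space_def)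
    then have f_eq: "f = (\<lambda>x. \<Sum>j = 1..s div 2.
        a j * cos (real (2 * j - 1) * x) + b j * sin (real (2 * j - 1) * x))"
      by (auto simp: of_nat_diff intro!: sum.cong)
    have "2 * j - 1 < s \<and> even (s - 1 - (2 * j - 1))" if "j \<in> {1..s div 2}" for j
      using that False s by auto
    then show ?thesis unfolding f_eq by (intro add sum scale cos sin) auto
  qed
qed

lemma trig_space_smooth: "1 \<le> s \<Longrightarrow> f \<in> trig_space s \<Longrightarrow> smooth f"
  by (induction rule: trig_space_induct) (auto intro: smooth_intros)

lemma trig_space_shift:
  "1 \<le> s \<Longrightarrow> f \<in> trig_space s \<Longrightarrow> f (x + pi) = (- 1) ^ (s - 1) * f x"
proof (induction arbitrary: x rule: trig_space_induct)
  case (cos k)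
  then have "(- 1 :: real) ^ (s - 1) = (- 1) ^ k"
    by (auto simp: minus_one_power_iff)
  then show ?case by (simp add: distrib_left cos_add cos_npi sin_npi)
next
  case (sin k)
  then have "(- 1 :: real) ^ (s - 1) = (- 1) ^ k"
    by (auto simp: minus_one_power_iff)
  then show ?case by (simp add: distrib_left sin_add cos_npi sin_npi)
qed (simp_all add: algebra_simps)

text \<open>With \<open>z = cis (2 * x)\<close> and \<open>s - 1 = k + 2 * r\<close>, the factor
  \<open>cis ((s - 1) * x)\<close> turns the exponentials of frequency \<open>k\<close> and
  \<open>-k\<close> into \<open>z ^ (k + r)\<close> and \<open>z ^ r\<close>.\<close>

lemma trig_space_poly:
  assumes "1 \<le> s" "f \<in> trig_space s"
  shows "\<exists>p. degree p \<le> s - 1 \<and>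
    (\<forall>x. complex_of_real (f x) * cis (real (s - 1) * x) = poly p (cis (2 * x)))"
  using assms
proof (induction rule: trig_space_induct)
  case (cos k)
  then obtain r where r: "s - 1 = k + 2 * r"
    by (metis Suc_pred' evenE le_add_diff_inverse less_Suc_eq_le less_nat_zero_code not_gr_zero)
  define p :: "complex poly" where "p = monom (1 / 2) (k + r) + monom (1 / 2) r"
  have "complex_of_real (cos (real k * x)) * cis (real (s - 1) * x) = poly p (cis (2 * x))" for x
  proof -
    have "complex_of_real (cos (real k * x)) = (cis (real k * x) + cis (- (real k * x))) / 2"
      by (simp add: complex_eq_iff)
    then have "complex_of_real (cos (real k * x)) * cis (real (s - 1) * x)
      = (cis (real k * x) * cis (real (s - 1) * x) + cis (- (real k * x)) * cis (real (s - 1) * x)) / 2"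
      by (simp only: times_divide_eq_left distrib_right)
    also have "\<dots> = poly p (cis (2 * x))"
      unfolding cis_mult p_def poly_add poly_monom DeMoivre r by (simp add: algebra_simps)
    finally show ?thesis .
  qed
  moreover have "degree p \<le> s - 1"
    unfolding p_def r by (intro degree_add_le order_trans[OF degree_monom_le]) auto
  ultimately show ?case by blast
next
  case (sin k)
  then obtain r where r: "s - 1 = k + 2 * r"
    by (metis Suc_pred' evenE le_add_diff_inverse less_Suc_eq_le less_nat_zero_code not_gr_zero)
  define p :: "complex poly" where "p = monom (- \<i> / 2) (k + r) + monom (\<i> / 2) r"
  have "complex_of_real (sin (real k * x)) * cis (real (s - 1) * x) = poly p (cis (2 * x))" for x
  proof -
    have "complex_of_real (sin (real k * x)) = - \<i> / 2 * cis (real k * x) + \<i> / 2 * cis (- (real k * x))"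
      by (simp add: complex_eq_iff)
    then have "complex_of_real (sin (real k * x)) * cis (real (s - 1) * x)
      = - \<i> / 2 * (cis (real k * x) * cis (real (s - 1) * x))
        + \<i> / 2 * (cis (- (real k * x)) * cis (real (s - 1) * x))"
      by (simp only: mult.assoc distrib_right)
    also have "\<dots> = poly p (cis (2 * x))"
      unfolding cis_mult p_def poly_add poly_monom DeMoivre r by (simp add: algebra_simps)
    finally show ?thesis .
  qed
  moreover have "degree p \<le> s - 1"
    unfolding p_def r by (intro degree_add_le order_trans[OF degree_monom_le]) auto
  ultimately show ?case by blast
next
  case (add f g)
  then obtain p q where "degree p \<le> s - 1" "degree q \<le> s - 1"
    "\<And>x. complex_of_real (f x) * cis (real (s - 1) * x) = poly p (cis (2 * x))"
    "\<And>x. complex_of_real (g x) * cis (real (s - 1) * x) = poly q (cis (2 * x))" by blast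
  then show ?case
    by (intro exI[of _ "p + q"]) (auto intro: degree_add_le simp: distrib_right)
next
  case (scale c f)
  then obtain p where "degree p \<le> s - 1"
    "\<And>x. complex_of_real (f x) * cis (real (s - 1) * x) = poly p (cis (2 * x))" by blast
  then show ?case
    by (intro exI[of _ "Polynomial.smult (of_real c) p"])
      (auto intro: order_trans[OF degree_smult_le] simp: mult.assoc)
qed

lemma inj_on_cis_double: "inj_on (\<lambda>x. cis (2 * x)) {0..<pi}"
proof (rule inj_onI)
  fix x y assume x: "x \<in> {0..<pi}" "y \<in> {0..<pi}" "cis (2 * x) = cis (2 * y)"
  have "cis (2 * x - 2 * y) = 1" using x(3) by (simp add: cis_divide[symmetric])
  then have "cos (2 * x - 2 * y) = 1" by (simp add: complex_eq_iff)
  then obtain k :: int where "2 * x - 2 * y = of_int k * 2 * pi" using cos_one_2pi_int by blast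
  then have k: "x - y = of_int k * pi" by simp
  have "\<bar>x - y\<bar> < pi" using x by auto
  then have "\<bar>of_int k\<bar> * pi < 1 * pi" unfolding k abs_mult by simp
  then have "\<bar>of_int k :: real\<bar> < 1" by (simp add: mult_less_cancel_right)
  then have "k = 0" by linarith
  then show "x = y" using k by simp
qed

text \<open>Zeros in one period give distinct roots on the unit circle of a nonzero polynomial of
  degree at most \<open>s - 1\<close>.\<close>

lemma zcount_trig_space:
  assumes "1 \<le> s" "f \<in> trig_space s" "f \<noteq> (\<lambda>x. 0)"
  shows "zcount f \<le> s - 1"
proof -
  obtain p where deg: "degree p \<le> s - 1"
    and p: "\<And>x. complex_of_real (f x) * cis (real (s - 1) * x) = poly p (cis (2 * x))"
    using trig_space_poly[OF assms(1,2)] by blast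
  have "p \<noteq> 0"
  proof
    assume "p = 0"
    then have "f x = 0" for x using p[of x] by simp
    then show False using assms(3) by auto
  qed
  have "(\<lambda>x. cis (2 * x)) ` zeros f 0 \<subseteq> {z. poly p z = 0}"
  proof safe
    fix x assume "x \<in> zeros f 0"
    then show "poly p (cis (2 * x)) = 0" using p[of x] by (simp add: zeros_def)
  qed
  moreover have "inj_on (\<lambda>x. cis (2 * x)) (zeros f 0)"
    by (rule inj_on_subset[OF inj_on_cis_double]) (auto simp: zeros_def)
  ultimately have "zcount f \<le> card {z. poly p z = 0}"
    unfolding zcount_def using poly_roots_finite[OF \<open>p \<noteq> 0\<close>] by (intro card_inj_on_le) auto
  also have "\<dots> \<le> degree p" by (rule card_poly_roots_bound[OF \<open>p \<noteq> 0\<close>])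
  finally show ?thesis using deg by simp
qed

text \<open>Gronwall's argument for \<open>E = f^2 + f'^2\<close>: from
  \<open>|E'| \<le> (1 + C) E\<close>, a suitable exponential weight makes \<open>E\<close> monotone
  on either side of \<open>a\<close>, where it is zero.\<close>

lemma ode_double_zero:
  fixes f :: "real \<Rightarrow> real"
  assumes f: "smooth f" "\<And>x. deriv (deriv f) x = v x * f x" and C: "\<And>x. \<bar>v x\<bar> \<le> C"
    and 0: "f a = 0" "deriv f a = 0"
  shows "f x = 0"
proof -
  define E where "E x = (f x)\<^sup>2 + (deriv f x)\<^sup>2" for x
  define E' where "E' x = 2 * f x * deriv f x * (1 + v x)" for x
  have E: "(E has_real_derivative E' x) (at x)" for x
    unfolding E_def E'_def
    by (rule derivative_eq_intros smooth_DERIV smooth_deriv f(1) refl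
        | simp add: f(2) algebra_simps)+
  have bound: "\<bar>E' x\<bar> \<le> (1 + C) * E x" for x
  proof -
    have "2 * \<bar>f x\<bar> * \<bar>deriv f x\<bar> \<le> E x"
      using sum_squares_bound[of "\<bar>f x\<bar>" "\<bar>deriv f x\<bar>"] by (simp add: E_def)
    moreover have "\<bar>1 + v x\<bar> \<le> 1 + C" using C[of x] by linarith
    ultimately have "2 * \<bar>f x\<bar> * \<bar>deriv f x\<bar> * \<bar>1 + v x\<bar> \<le> E x * (1 + C)"
      by (intro mult_mono) (auto simp: E_def)
    moreover have "\<bar>E' x\<bar> = 2 * \<bar>f x\<bar> * \<bar>deriv f x\<bar> * \<bar>1 + v x\<bar>"
      unfolding E'_def abs_mult by simp
    ultimately show ?thesis by (simp add: mult.commute)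
  qed
  have scaled: "((\<lambda>x. E x * exp (c * x)) has_real_derivative (E' x + c * E x) * exp (c * x)) (at x)"
    for c x by (rule derivative_eq_intros E refl | simp add: algebra_simps)+
  have Ea: "E a = 0" using 0 by (simp add: E_def)
  have "E x \<le> 0"
  proof (cases "a \<le> x")
    case True
    have "E x * exp (- (1 + C) * x) \<le> E a * exp (- (1 + C) * a)"
    proof (rule DERIV_nonpos_imp_nonincreasing[OF True])
      fix t
      have "E' t + - (1 + C) * E t \<le> 0" using bound[of t] unfolding mult_minus_left by linarith
      then have "(E' t + - (1 + C) * E t) * exp (- (1 + C) * t) \<le> 0"
        by (rule mult_nonpos_nonneg) simp
      then show "\<exists>y. DERIV (\<lambda>x. E x * exp (- (1 + C) * x)) t :> y \<and> y \<le> 0" using scaled by blast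
    qed
    then show ?thesis by (simp add: Ea mult_le_0_iff)
  next
    case False
    then have xa: "x \<le> a" by simp
    have "E x * exp ((1 + C) * x) \<le> E a * exp ((1 + C) * a)"
    proof (rule DERIV_nonneg_imp_nondecreasing[OF xa])
      fix t
      have "0 \<le> (E' t + (1 + C) * E t) * exp ((1 + C) * t)"
        using bound[of t] by (intro mult_nonneg_nonneg) auto
      then show "\<exists>y. DERIV (\<lambda>x. E x * exp ((1 + C) * x)) t :> y \<and> 0 \<le> y" using scaled by blast
    qed
    then show ?thesis by (simp add: Ea mult_le_0_iff)
  qed
  then have "(f x)\<^sup>2 \<le> 0" unfolding E_def using zero_le_power2[of "deriv f x"] by linarith
  then show ?thesis by simp
qed

section \<open>The Whittaker-Hill eigenfunctions as a Hill system\<close>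

definition wh_potential :: "nat \<Rightarrow> real \<Rightarrow> real \<Rightarrow> real" where
  "wh_potential s \<alpha> x = - (4 * \<alpha> * real s * cos (2 * x) + 2 * \<alpha>\<^sup>2 * cos (4 * x))"

lemma eigfun_psi:
  assumes s: "1 \<le> s" and f: "K_eigenfunction s \<alpha> \<mu> f"
  shows "eigfun ((- 1) ^ (s - 1)) (wh_potential s \<alpha>) (\<mu> - 2 * \<alpha>\<^sup>2) (psi \<alpha> f)"
proof -
  have f': "f \<in> trig_space s" "f \<noteq> (\<lambda>x. 0)" using f by (auto simp: K_eigenfunction_def)
  have smooth: "smooth (psi \<alpha> f)"
    unfolding psi_def[abs_def] by (intro smooth_intros trig_space_smooth[OF s f'(1)])
  have ode: "deriv (deriv (psi \<alpha> f)) x = (wh_potential s \<alpha> x - (\<mu> - 2 * \<alpha>\<^sup>2)) * psi \<alpha> f x" for x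
    using fun_cong[OF L_op_psi[OF f], of x]
    by (simp add: L_op_def wh_potential_def numeral_2_eq_2 algebra_simps)
  have "cos (2 * (x + pi)) = cos (2 * x)" for x
    by (simp add: distrib_left cos_add)
  then have shift: "psi \<alpha> f (x + pi) = (- 1) ^ (s - 1) * psi \<alpha> f x" for x
    by (simp add: psi_def trig_space_shift[OF s f'(1)])
  \<comment> \<open>A uniform bound on the coefficient, as required for excluding double zeros of a
    nontrivial solution.\<close>
  have "\<bar>wh_potential s \<alpha> x - (\<mu> - 2 * \<alpha>\<^sup>2)\<bar>
      \<le> \<bar>4 * \<alpha> * real s\<bar> + \<bar>2 * \<alpha>\<^sup>2\<bar> + \<bar>\<mu> - 2 * \<alpha>\<^sup>2\<bar>" for x
  proof -
    have "\<bar>4 * \<alpha> * real s * cos (2 * x)\<bar> \<le> \<bar>4 * \<alpha> * real s\<bar>"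
      "\<bar>2 * \<alpha>\<^sup>2 * cos (4 * x)\<bar> \<le> \<bar>2 * \<alpha>\<^sup>2\<bar>"
      by (simp_all only: abs_mult[of _ "cos _"] mult_left_le abs_cos_le_one abs_ge_zero)
    then show ?thesis unfolding wh_potential_def by linarith
  qed
  note double_zero = ode_double_zero[OF smooth ode this]
  obtain z where "f z \<noteq> 0" using f'(2) by auto
  then have "psi \<alpha> f z \<noteq> 0" by (simp add: psi_def)
  then have "psi \<alpha> f x \<noteq> 0 \<or> deriv (psi \<alpha> f) x \<noteq> 0" for x using double_zero by blast
  then show ?thesis unfolding eigfun_def using smooth ode shift by blast
qed


section \<open>Wronskians\<close>

lemma hill_system_psi:
  assumes s: "1 \<le> s" and sys: "eigensystem s \<alpha> \<nu> \<phi>"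
  shows "hill_system ((- 1) ^ (s - 1)) (wh_potential s \<alpha>) (if odd s then 0 else 1) (s div 2)
    (\<lambda>i. \<nu> i - 2 * \<alpha>\<^sup>2) (\<lambda>i. psi \<alpha> (\<phi> i))"
proof -
  define e :: nat where "e = (if odd s then 0 else 1)"
  have I: "index_set s = {e..2 * (s div 2)}" by (simp add: index_set_def e_def)
  \<comment> \<open>The identity \<open>s - 1 + e = 2 * (s div 2)\<close> turns the degree bound on
    zeros into exactly the bound required of the top function.\<close>
  have top: "2 * (s div 2) \<in> index_set s" and s_eq: "s - 1 + e = 2 * (s div 2)"
    using s by (auto simp: I e_def elim!: oddE)
  have K: "K_eigenfunction s \<alpha> (\<nu> i) (\<phi> i)" if "i \<in> index_set s" for i
    using sys that by (auto simp: eigensystem_def)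
  have "zcount (psi \<alpha> (\<phi> (2 * (s div 2)))) = zcount (\<phi> (2 * (s div 2)))"
    by (simp add: zcount_def zeros_def psi_def)
  also have "\<dots> \<le> s - 1"
    using K[OF top] s by (intro zcount_trig_space) (auto simp: K_eigenfunction_def)
  finally have "zcount (psi \<alpha> (\<phi> (2 * (s div 2)))) + e \<le> 2 * (s div 2)"
    using s_eq by linarith
  moreover have "strict_mono_on (index_set s) (\<lambda>i. \<nu> i - 2 * \<alpha>\<^sup>2)"
    using sys by (auto simp: eigensystem_def strict_mono_on_def)
  moreover have "\<forall>i \<in> index_set s.
      eigfun ((- 1) ^ (s - 1)) (wh_potential s \<alpha>) (\<nu> i - 2 * \<alpha>\<^sup>2) (psi \<alpha> (\<phi> i))"
    using eigfun_psi[OF s K] by blast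
  moreover have "(- 1 :: real) ^ (s - 1) = 1 \<and> e = 0 \<or> (- 1 :: real) ^ (s - 1) = - 1 \<and> e = 1"
    using s by (auto simp: e_def minus_one_power_iff)
  ultimately show ?thesis unfolding hill_system_def I e_def[symmetric] by blast
qed

text \<open>A kernel vector of the singular Wronski matrix at the single point \<open>x\<close>
  supplies the coefficients; its rows state that the combination vanishes there to order
  \<open>card I\<close>.\<close>

lemma wronskian_zero_imp_dependent:
  assumes fin: "finite I" and sm: "\<And>i. i \<in> I \<Longrightarrow> smooth (f i)"
    and 0: "wronskian (map f (sorted_list_of_set I)) x = 0"
  shows "\<exists>c. (\<exists>i \<in> I. c i \<noteq> 0) \<and> vanishes (card I) (\<lambda>x. \<Sum>i\<in>I. c i * f i x) x"
proof -
  define xs where "xs = sorted_list_of_set I"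
  define k where "k = card I"
  have len: "length xs = k" by (simp add: xs_def k_def)
  have bij: "bij_betw (\<lambda>q. xs ! q) {..<k} I"
    by (rule bij_betw_nth) (simp_all add: xs_def k_def fin)
  define A where "A = mat k k (\<lambda>(p, q). (deriv ^^ p) (f (xs ! q)) x)"
  have "A = mat k k (\<lambda>(p, q). (deriv ^^ p) (map f xs ! q) x)"
    unfolding A_def by (rule cong_mat) (auto simp: len)
  then have "det A = 0" using 0 by (simp add: wronskian_def xs_def[symmetric] len)
  moreover have "A \<in> carrier_mat k k" by (simp add: A_def)
  ultimately obtain v where v: "v \<in> carrier_vec k" "v \<noteq> 0\<^sub>v k" "A *\<^sub>v v = 0\<^sub>v k"
    using det_0_iff_vec_prod_zero_field by blast
  \<comment> \<open>The entries of \<open>v\<close> are numbered by positions in the sorted list;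
    this transports them to the elements of \<open>I\<close>.\<close>
  define c where "c i = v $ inv_into {..<k} (\<lambda>q. xs ! q) i" for i
  have c: "c (xs ! q) = v $ q" if "q < k" for q
    unfolding c_def using bij that by (subst inv_into_f_f) (auto simp: bij_betw_def)
  obtain q where q: "q < k" "v $ q \<noteq> 0"
    using v(1,2) by (metis carrier_vecD eq_vecI index_zero_vec)
  have "\<exists>i \<in> I. c i \<noteq> 0"
    using q c bij_betwE[OF bij] by (intro bexI[of _ "xs ! q"]) auto
  moreover have "(deriv ^^ p) (\<lambda>x. \<Sum>i\<in>I. c i * f i x) x = 0" if "p < k" for p
  proof -
    have "(\<Sum>i\<in>I. c i * (deriv ^^ p) (f i) x) = (\<Sum>q<k. c (xs ! q) * (deriv ^^ p) (f (xs ! q)) x)"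
      by (rule sum.reindex_bij_betw[OF bij, symmetric])
    also have "\<dots> = (\<Sum>q<k. A $$ (p, q) * v $ q)"
      using that by (intro sum.cong) (auto simp: A_def c)
    also have "\<dots> = (A *\<^sub>v v) $ p"
      using that v(1) by (simp add: A_def scalar_prod_def atLeast0LessThan)
    finally show ?thesis using that v(3) by (simp add: higher_deriv_lincomb[OF sm])
  qed
  ultimately show ?thesis unfolding vanishes_def k_def by blast
qed

theorem theorem2:
  fixes s :: nat and \<alpha> :: real and \<nu> :: "nat \<Rightarrow> real" and \<phi> :: "nat \<Rightarrow> real \<Rightarrow> real"
    and I :: "nat set"
  assumes "s \<ge> 1" and "\<alpha> > 0"
    and "eigensystem s \<alpha> \<nu> \<phi>"
    and "cluster_subset s I" and "I \<noteq> {}"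
  shows "\<forall>x. wronskian (map (\<lambda>i. psi \<alpha> (\<phi> i)) (sorted_list_of_set I)) x \<noteq> 0"
proof (intro allI notI)
  fix x
  assume 0: "wronskian (map (\<lambda>i. psi \<alpha> (\<phi> i)) (sorted_list_of_set I)) x = 0"
  note sys = hill_system_psi[OF assms(1,3)]
  \<comment> \<open>The substitution \<open>j = Suc l\<close> rewrites the cluster condition without
    truncated subtraction.\<close>
  have I: "I \<subseteq> {if odd s then 0 else 1..2 * (s div 2)}"
    "\<And>l. Suc l \<le> s div 2 \<Longrightarrow> Suc (2 * l) \<in> I \<longleftrightarrow> 2 * Suc l \<in> I"
  proof -
    show "I \<subseteq> {if odd s then 0 else 1..2 * (s div 2)}"
      using assms(4) by (auto simp: cluster_subset_iff index_set_def split: if_splits)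
    fix l assume "Suc l \<le> s div 2"
    then have "2 * Suc l - 1 \<in> I \<longleftrightarrow> 2 * Suc l \<in> I"
      using assms(4) unfolding cluster_subset_iff by force
    then show "Suc (2 * l) \<in> I \<longleftrightarrow> 2 * Suc l \<in> I" by simp
  qed
  have "finite I" using I(1) finite_subset by blast
  moreover have "smooth (psi \<alpha> (\<phi> i))" if "i \<in> I" for i
    using eigfunD(1)[OF eig[OF sys]] I(1) that by blast
  ultimately obtain c i where c: "i \<in> I" "c i \<noteq> 0"
    "vanishes (card I) (\<lambda>x. \<Sum>i\<in>I. c i * psi \<alpha> (\<phi> i) x) x"
    using wronskian_zero_imp_dependent[OF _ _ 0] by blast
  then show False using lincomb_zero[OF sys I c(3,1)] by blast
qed

end
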